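(* Let $n\ge3$, $l\ge1$, $f=f_{[n]}$ and $\phi:=\exp(f^lD)\circ\exp(D')\circ\exp(-f^lD)$. Then the group $G:=\langle\phi,\mathrm{Tr}_n(k)\rangle$ is the free product of $\langle\phi\rangle$ and $\mathrm{Tr}_n(k)$, and $G\cap\mathrm{Aff}_n(k)=\mathrm{Tr}_n(k)$. Equivalently, for every $s\ge1$, all $i_1,\ldots,i_s\in\mathbb{Z}\setminus\{0\}$ and all $\mathbf{a}_1,\ldots,\mathbf{a}_{s-1}\in k^n\setminus\{\mathbf 0\}$, $\phi^{i_1}\circ\tau_{\mathbf{a}_1}\circ\cdots\circ\phi^{i_{s-1}}\circ\tau_{\mathbf{a}_{s-1}}\circ\phi^{i_s}\notin\mathrm{Aff}_n(k)$.
   Context: Let $k$ be a field of characteristic zero and $k[\mathbf{x}]=k[x_1,\ldots,x_n]$, $n\ge3$. Automorphisms of $k[\mathbf{x}]$ are written $\phi=(\phi(x_1),\ldots,\phi(x_n))$, $\circ$ is composition. $\mathrm{Aff}_n(k)$ is the group of affine automorphisms $(x_1,\ldots,x_n)A+\mathbf{b}$, $A\in GL_n(k)$, $\mathbf{b}\in k^n$. For $\mathbf{a}\in k^n$, $\tau_{\mathbf{a}}=(x_1,\ldots,x_n)+\mathbf{a}$ is the translation, and $\mathrm{Tr}_n(k)=\{\tau_{\mathbf{a}}\mid\mathbf{a}\in k^n\}$. For a locally nilpotent derivation $E$, $\exp E(g)=\sum_{i\ge0}E^i(g)/i!$. $D=\sum_{j=1}^{n-1}(n-j)\,x_{j+1}\,\partial/\partial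 x_j$, $D'=\sum_{j=2}^{n}(j-1)\,x_{j-1}\,\partial/\partial x_j$. $f_{[2m-1]}=\frac12\sum_{i=1}^{2m-1}(-1)^{i-1}\binom{2m-2}{i-1}x_ix_{2m-i}$ for $n=2m-1$, $m\ge 2$; $f_{[2m]}=D(f_{[2m-1]})^2-2D^2(f_{[2m-1]})f_{[2m-1]}$ for $n=2m$, $m\ge2$. It is known that $f_{[n]}\in\ker D\cap\ker D'$, so $f^lD$ is locally nilpotent. *)

theory Defs
  imports "HOL-Library.Poly_Mapping"
begin

type_synonym 'k mpoly = "(nat \<Rightarrow>\<^sub>0 nat) \<Rightarrow>\<^sub>0 'k"

definition Var :: "nat \<Rightarrow> 'k::comm_ring_1 mpoly" where
  "Var i = Poly_Mapping.single (Poly_Mapping.single i 1) 1"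

definition Const :: "'k::comm_ring_1 \<Rightarrow> 'k mpoly" where
  "Const c = Poly_Mapping.single 0 c"

text \<open>variables occurring in a polynomial; k[x_1..x_n] = polys with vars in {1..n}\<close>
definition vars :: "'k::comm_ring_1 mpoly \<Rightarrow> nat set" where
  "vars p = (\<Union>m\<in>Poly_Mapping.keys p. Poly_Mapping.keys m)"

definition pdiff :: "nat \<Rightarrow> 'k::comm_ring_1 mpoly \<Rightarrow> 'k mpoly" where
  "pdiff i p = (\<Sum>m\<in>Poly_Mapping.keys p.
      Poly_Mapping.single (m - Poly_Mapping.single i 1)
        (Poly_Mapping.lookup p m * of_nat (Poly_Mapping.lookup m i)))"

definition subst :: "(nat \<Rightarrow> 'k::comm_ring_1 mpoly) \<Rightarrow> 'k mpoly \<Rightarrow> 'k mpoly" where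
  "subst s p = (\<Sum>m\<in>Poly_Mapping.keys p.
      Const (Poly_Mapping.lookup p m) *
      (\<Prod>i\<in>Poly_Mapping.keys m. s i ^ Poly_Mapping.lookup m i))"

section \<open>Endomorphisms of k[x_1..x_n] as tuples (phi(x_1),...,phi(x_n));
  components outside {1..n} are kept equal to x_i\<close>

definition comp_aut :: "(nat \<Rightarrow> 'k::comm_ring_1 mpoly) \<Rightarrow> (nat \<Rightarrow> 'k mpoly) \<Rightarrow> nat \<Rightarrow> 'k mpoly" where
  "comp_aut phi psi = (\<lambda>i. subst phi (psi i))"

definition normalized :: "nat \<Rightarrow> (nat \<Rightarrow> 'k::comm_ring_1 mpoly) \<Rightarrow> bool" where
  "normalized n psi \<longleftrightarrow> (\<forall>i. i \<notin> {1..n} \<longrightarrow> psi i = Var i) \<and>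
                          (\<forall>i\<in>{1..n}. vars (psi i) \<subseteq> {1..n})"

definition aut_inv :: "nat \<Rightarrow> (nat \<Rightarrow> 'k::comm_ring_1 mpoly) \<Rightarrow> nat \<Rightarrow> 'k mpoly" where
  "aut_inv n phi = (THE psi. normalized n psi \<and> comp_aut phi psi = Var \<and> comp_aut psi phi = Var)"

definition aut_pow :: "nat \<Rightarrow> (nat \<Rightarrow> 'k::comm_ring_1 mpoly) \<Rightarrow> int \<Rightarrow> nat \<Rightarrow> 'k mpoly" where
  "aut_pow n phi i = (if 0 \<le> i then (comp_aut phi ^^ nat i) Var
                      else (comp_aut (aut_inv n phi) ^^ nat (- i)) Var)"

text \<open>exp E (g) = sum_{i>=0} E^i(g)/i! for a locally nilpotent E\<close>
definition lnd_exp :: "('k::field_char_0 mpoly \<Rightarrow> 'k mpoly) \<Rightarrow> 'k mpoly \<Rightarrow> 'k mpoly" where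
  "lnd_exp E g = (\<Sum>i<(LEAST N. (E ^^ N) g = 0). Const (1 / fact i) * (E ^^ i) g)"

definition exp_aut :: "nat \<Rightarrow> ('k::field_char_0 mpoly \<Rightarrow> 'k mpoly) \<Rightarrow> nat \<Rightarrow> 'k mpoly" where
  "exp_aut n E = (\<lambda>i. if i \<in> {1..n} then lnd_exp E (Var i) else Var i)"

definition derD :: "nat \<Rightarrow> 'k::comm_ring_1 mpoly \<Rightarrow> 'k mpoly" where
  "derD n p = (\<Sum>j=1..n-1. Const (of_nat (n - j)) * Var (j + 1) * pdiff j p)"

definition derD' :: "nat \<Rightarrow> 'k::comm_ring_1 mpoly \<Rightarrow> 'k mpoly" where
  "derD' n p = (\<Sum>j=2..n. Const (of_nat (j - 1)) * Var (j - 1) * pdiff j p)"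

definition f_odd :: "nat \<Rightarrow> 'k::field_char_0 mpoly" where
  "f_odd m = Const (1/2) * (\<Sum>i=1..2*m-1.
      Const ((-1) ^ (i - 1) * of_nat ((2*m-2) choose (i - 1))) * Var i * Var (2*m - i))"

definition f_n :: "nat \<Rightarrow> 'k::field_char_0 mpoly" where
  "f_n n = (if odd n then f_odd ((n + 1) div 2)
            else (derD n (f_odd (n div 2))) ^ 2
                 - Const 2 * derD n (derD n (f_odd (n div 2))) * f_odd (n div 2))"

definition phi_map :: "nat \<Rightarrow> nat \<Rightarrow> nat \<Rightarrow> 'k::field_char_0 mpoly" where
  "phi_map n l = comp_aut (exp_aut n (\<lambda>g. f_n n ^ l * derD n g))
                   (comp_aut (exp_aut n (derD' n))
                      (exp_aut n (\<lambda>g. - (f_n n ^ l * derD n g))))"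

definition tau :: "nat \<Rightarrow> (nat \<Rightarrow> 'k::comm_ring_1) \<Rightarrow> nat \<Rightarrow> 'k mpoly" where
  "tau n a = (\<lambda>j. if j \<in> {1..n} then Var j + Const (a j) else Var j)"

definition is_affine :: "nat \<Rightarrow> (nat \<Rightarrow> 'k::field mpoly) \<Rightarrow> bool" where
  "is_affine n phi \<longleftrightarrow> (\<exists>A B :: nat \<Rightarrow> nat \<Rightarrow> 'k. \<exists>b :: nat \<Rightarrow> 'k.
      (\<forall>i\<in>{1..n}. \<forall>j\<in>{1..n}.
          (\<Sum>k=1..n. A i k * B k j) = (if i = j then 1 else 0) \<and>
          (\<Sum>k=1..n. B i k * A k j) = (if i = j then 1 else 0)) \<and>
      (\<forall>j\<in>{1..n}. phi j = (\<Sum>i=1..n. Const (A i j) * Var i) + Const (b j)))"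

fun word :: "nat \<Rightarrow> (nat \<Rightarrow> 'k::comm_ring_1 mpoly) \<Rightarrow> int list \<Rightarrow> (nat \<Rightarrow> 'k) list \<Rightarrow> nat \<Rightarrow> 'k mpoly" where
  "word n phi [] as = Var"
| "word n phi [i] as = aut_pow n phi i"
| "word n phi (i # j # is) as =
     comp_aut (aut_pow n phi i) (comp_aut (tau n (hd as)) (word n phi (j # is) (tl as)))"

end

theory Submission
  imports Defs "HOL-Computational_Algebra.Polynomial"
begin

text \<open>Since \<open>f\<close> is invariant under \<open>exp(c D)\<close> and \<open>exp(t D')\<close>, on points the power \<open>phi^i\<close> acts as
  \<open>v \<mapsto> M(f(v)^l, i) v\<close>, where \<open>M(c, t) = exp(-cD) exp(tD') exp(cD)\<close> is linear in \<open>v\<close> and polynomial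
  in \<open>c\<close>. Apply a word to a curve \<open>v \<in> k[t]^n\<close> with \<open>deg v_j \<le> d + (n-j)P\<close> and equality for \<open>j = n\<close>, such
  that \<open>C = deg f(v)^l\<close> satisfies \<open>d + (n-1)P < (n-1)C\<close>. The components of \<open>v' = M(f(v)^l, i) v\<close> have
  degrees \<open>d + (n-1)C + (n-j)C\<close>, and for constant \<open>a \<noteq> 0\<close> the degree of
  \<open>f(v' + a) = f(v + M(f(v)^l, -i) a)\<close> is so large that \<open>v' + a\<close> is a curve of the same kind. So the
  degree of the last component exceeds 1 after the first power of \<open>phi\<close> and keeps growing, whereas an
  affine map sends the line \<open>t (e_1 + e_n)\<close> to a curve of degree at most 1.\<close>

section \<open>Evaluation of multivariate polynomials\<close>

text \<open>The obstacle is cancellation. The components of v' have degrees up to d + 2(n-1)C, yet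
  f(v') = f(v) has degree at most C, so the leading terms of v' + a say nothing about f(v' + a).
  Pulling the translation back by M(f(v)^l, -i), with the parameter frozen so that the map is
  linear, yields a sum v + w of curves whose degrees rise with different slopes, P for v and C for
  w. When x_1 is paired with x_n, the product v_n w_1 is then the only summand of top degree and
  cannot cancel. For odd n this is enough, f being a quadratic form with f(v) and f(w) = f(a) under
  control. For even n, f is a quarter of a discriminant q1^2 - 4 q0 q2, and the square of the
  pairing has to beat every other term of a quartic; d + (n-1)P < (n-1)C serves these estimates. The
  inequality reproduces itself: the new curve has last degree d + (n-1)C and slope C, deg f has
  grown to at least d + (n-1)C, and n - 1 >= 2 with d >= 1 leaves room.\<close>

lemma mpoly_sum_singles:
  fixes p :: "'k::comm_ring_1 mpoly"
  shows "p = (\<Sum>m\<in>Poly_Mapping.keys p. Poly_Mapping.single m (Poly_Mapping.lookup p m))"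
proof (rule poly_mapping_eqI)
  fix m
  show "Poly_Mapping.lookup p m =
    Poly_Mapping.lookup (\<Sum>m\<in>Poly_Mapping.keys p. Poly_Mapping.single m (Poly_Mapping.lookup p m)) m"
    by (simp add: lookup_sum lookup_single when_def in_keys_iff)
qed

lemma mpoly_induct [case_names single add]:
  fixes p :: "'k::comm_ring_1 mpoly"
  assumes "\<And>m c. P (Poly_Mapping.single m c)" and "\<And>p q. P p \<Longrightarrow> P q \<Longrightarrow> P (p + q)"
  shows "P p"
proof -
  have "P (\<Sum>m\<in>S. Poly_Mapping.single m (Poly_Mapping.lookup p m))" if "finite S" for S
    using that
  proof (induction S)
    case empty
    then show ?case using assms(1)[of 0 0] by simp
  qed (simp add: assms)
  then show ?thesis by (subst mpoly_sum_singles) simp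
qed

lemma sum_keys_add:
  fixes p q :: "'a \<Rightarrow>\<^sub>0 'b::comm_monoid_add" and g :: "'a \<Rightarrow> 'b \<Rightarrow> 'c::comm_monoid_add"
  assumes "\<And>m. g m 0 = 0" and "\<And>m a b. g m (a + b) = g m a + g m b"
  shows "(\<Sum>m\<in>Poly_Mapping.keys (p + q). g m (Poly_Mapping.lookup (p + q) m)) =
    (\<Sum>m\<in>Poly_Mapping.keys p. g m (Poly_Mapping.lookup p m)) +
    (\<Sum>m\<in>Poly_Mapping.keys q. g m (Poly_Mapping.lookup q m))"
proof -
  let ?K = "Poly_Mapping.keys p \<union> Poly_Mapping.keys q"
  have ext: "(\<Sum>m\<in>Poly_Mapping.keys r. g m (Poly_Mapping.lookup r m)) =
      (\<Sum>m\<in>?K. g m (Poly_Mapping.lookup r m))" if "Poly_Mapping.keys r \<subseteq> ?K" for r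
    by (rule sum.mono_neutral_left) (use that assms in \<open>auto simp: in_keys_iff\<close>)
  show ?thesis
    unfolding ext[OF Poly_Mapping.keys_add[of p q]] ext[OF Un_upper1] ext[OF Un_upper2]
    by (simp add: lookup_add assms(2) sum.distrib)
qed

definition monom_val :: "(nat \<Rightarrow> 'a::comm_ring_1) \<Rightarrow> (nat \<Rightarrow>\<^sub>0 nat) \<Rightarrow> 'a" where
  "monom_val v m = (\<Prod>i\<in>Poly_Mapping.keys m. v i ^ Poly_Mapping.lookup m i)"

definition ev :: "('k::comm_ring_1 \<Rightarrow> 'a::comm_ring_1) \<Rightarrow> (nat \<Rightarrow> 'a) \<Rightarrow> 'k mpoly \<Rightarrow> 'a" where
  "ev h v p = (\<Sum>m\<in>Poly_Mapping.keys p. h (Poly_Mapping.lookup p m) * monom_val v m)"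

lemma subst_eq_ev: "subst = ev Const"
  by (simp add: subst_def ev_def monom_val_def fun_eq_iff)

lemma monom_val_superset:
  assumes "finite K" "Poly_Mapping.keys m \<subseteq> K"
  shows "monom_val v m = (\<Prod>i\<in>K. v i ^ Poly_Mapping.lookup m i)"
  unfolding monom_val_def
  by (rule prod.mono_neutral_left) (use assms in \<open>auto simp: in_keys_iff\<close>)

lemma monom_val_zero [simp]: "monom_val v 0 = 1"
  by (simp add: monom_val_def)

lemma monom_val_add: "monom_val v (m + m') = monom_val v m * monom_val v m'"
proof -
  let ?K = "Poly_Mapping.keys m \<union> Poly_Mapping.keys m'"
  have "monom_val v (m + m') = (\<Prod>i\<in>?K. v i ^ Poly_Mapping.lookup (m + m') i)"
    by (rule monom_val_superset) (use Poly_Mapping.keys_add[of m m'] in auto)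
  also have "\<dots> = monom_val v m * monom_val v m'"
    by (simp add: monom_val_superset[of ?K] lookup_add power_add prod.distrib)
  finally show ?thesis .
qed

lemma Const_add: "Const (a + b) = Const a + Const b"
  by (simp add: Const_def single_add)

lemma Const_mult: "Const (a * b) = Const a * Const b"
  by (simp add: Const_def mult_single)

lemma Const_0 [simp]: "Const 0 = 0" and Const_1 [simp]: "Const 1 = 1"
  by (simp_all add: Const_def)

text \<open>Coefficient maps for which \<open>ev\<close> is a ring homomorphism. Instances are
  \<open>Const\<close> for substitution, \<open>const_poly\<close> for curves, constants over one
  more polynomial ring for flows, and the value of a polynomial at a point. \<open>ev h v\<close> is
  itself an instance, which supplies its rules for sums, powers and numerals.\<close>

locale scalar_hom =
  fixes h :: "'k::comm_ring_1 \<Rightarrow> 'a::comm_ring_1"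
  assumes hom_add: "h (a + b) = h a + h b"
    and hom_mult: "h (a * b) = h a * h b"
    and hom_1 [simp]: "h 1 = 1"
begin

lemma hom_0 [simp]: "h 0 = 0"
  using hom_add[of 0 0] by simp

lemma hom_minus: "h (- a) = - h a"
  using hom_add[of a "- a"] by (simp add: eq_neg_iff_add_eq_0 add.commute)

lemma hom_diff: "h (a - b) = h a - h b"
  using hom_add[of a "- b"] by (simp add: hom_minus)

lemma hom_of_nat [simp]: "h (of_nat k) = of_nat k"
  by (induction k) (simp_all add: hom_add)

lemma hom_of_int [simp]: "h (of_int k) = of_int k"
  by (cases k rule: int_diff_cases) (simp add: hom_diff)

lemma hom_sum: "h (sum f S) = (\<Sum>x\<in>S. h (f x))"
  by (induction S rule: infinite_finite_induct) (simp_all add: hom_add)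

lemma hom_power: "h (a ^ k) = h a ^ k"
  by (induction k) (simp_all add: hom_mult)

lemma hom_numeral [simp]: "h (numeral k) = numeral k"
  using hom_of_nat[of "numeral k"] by simp

lemma ev_single: "ev h v (Poly_Mapping.single m c) = h c * monom_val v m"
  by (cases "c = 0") (simp_all add: ev_def)

lemma ev_Const [simp]: "ev h v (Const c) = h c"
  by (simp add: Const_def ev_single)

lemma ev_Var [simp]: "ev h v (Var i) = v i"
  by (simp add: Var_def ev_single monom_val_def)

lemma ev_add: "ev h v (p + q) = ev h v p + ev h v q"
  unfolding ev_def by (rule sum_keys_add) (simp_all add: hom_add algebra_simps)

lemma ev_mult: "ev h v (p * q) = ev h v p * ev h v q"
proof (induction p rule: mpoly_induct)
  case (single m c)
  show ?case
    by (induction q rule: mpoly_induct)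
      (simp_all add: mult_single ev_single hom_mult monom_val_add ev_add algebra_simps)
qed (simp add: ev_add algebra_simps)

lemma ev_0 [simp]: "ev h v 0 = 0" and ev_1 [simp]: "ev h v 1 = 1"
  using ev_Const[of v 0] ev_Const[of v 1] by simp_all

lemma ev_scalar_hom: "scalar_hom (ev h v)"
  by unfold_locales (simp_all add: ev_add ev_mult)

lemmas ev_minus = scalar_hom.hom_minus[OF ev_scalar_hom]
  and ev_diff = scalar_hom.hom_diff[OF ev_scalar_hom]
  and ev_sum = scalar_hom.hom_sum[OF ev_scalar_hom]
  and ev_power = scalar_hom.hom_power[OF ev_scalar_hom]
  and ev_of_nat [simp] = scalar_hom.hom_of_nat[OF ev_scalar_hom]
  and ev_of_int [simp] = scalar_hom.hom_of_int[OF ev_scalar_hom]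
  and ev_numeral [simp] = scalar_hom.hom_numeral[OF ev_scalar_hom]

end

interpretation Const: scalar_hom Const
  by unfold_locales (simp_all add: Const_add Const_mult)

lemma ev_Const_Var [simp]: "ev Const Var p = (p :: 'k::comm_ring_1 mpoly)"
proof -
  have power: "Var i ^ e = (Poly_Mapping.single (Poly_Mapping.single i e) 1 :: 'k mpoly)" for i e
    by (induction e) (simp_all add: Var_def mult_single flip: single_add)
  have "(\<Prod>i\<in>K. Var i ^ Poly_Mapping.lookup m i) =
      (Poly_Mapping.single (\<Sum>i\<in>K. Poly_Mapping.single i (Poly_Mapping.lookup m i)) 1 :: 'k mpoly)"
    if "finite K" for K m
    using that by induction (simp_all add: power mult_single)
  moreover have "m = (\<Sum>i\<in>Poly_Mapping.keys m. Poly_Mapping.single i (Poly_Mapping.lookup m i))"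
    for m :: "nat \<Rightarrow>\<^sub>0 nat"
    by (rule poly_mapping_eqI) (simp add: lookup_sum lookup_single when_def in_keys_iff)
  ultimately have "monom_val Var m = (Poly_Mapping.single m 1 :: 'k mpoly)" for m
    by (simp add: monom_val_def)
  then show ?thesis
    by (subst (3) mpoly_sum_singles) (simp add: ev_def Const_def mult_single)
qed

text \<open>Because p = \<open>ev Const Var p\<close>, constants and variables generate the ring, so
  identities between homomorphisms or derivations need checking on generators only.\<close>

lemma mpoly_ring_induct [case_names Const Var add mult]:
  fixes p :: "'k::comm_ring_1 mpoly"
  assumes "\<And>c. P (Const c)" and "\<And>i. P (Var i)"
    and "\<And>p q. P p \<Longrightarrow> P q \<Longrightarrow> P (p + q)" and "\<And>p q. P p \<Longrightarrow> P q \<Longrightarrow> P (p * q)"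
  shows "P p"
proof -
  have one: "P 1" using assms(1)[of 1] by simp
  have pow: "P (Var i ^ e)" for i e
    by (induction e) (simp_all add: one assms)
  have "P (monom_val Var m)" for m
    unfolding monom_val_def
    by (induction rule: infinite_finite_induct) (simp_all add: one assms pow)
  then have "P (ev Const Var p)"
    unfolding ev_def
    by (induction rule: infinite_finite_induct) (use assms assms(1)[of 0] in auto)
  then show ?thesis by simp
qed

context scalar_hom
begin

lemma ev_ev: "ev h v (ev Const s p) = ev h (\<lambda>i. ev h v (s i)) p"
  by (induction p rule: mpoly_ring_induct)
    (simp_all add: ev_add ev_mult Const.ev_add Const.ev_mult)

end

lemma comp_aut_Var [simp]: "comp_aut phi Var = phi" "comp_aut Var phi = phi"
  by (simp_all add: comp_aut_def subst_eq_ev)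

lemma comp_aut_assoc: "comp_aut (comp_aut a b) c = comp_aut a (comp_aut b c)"
  by (simp add: comp_aut_def subst_eq_ev Const.ev_ev)

section \<open>Partial derivatives and the derivations D and D'\<close>

lemma pdiff_single: "pdiff i (Poly_Mapping.single m c) =
    Poly_Mapping.single (m - Poly_Mapping.single i 1) (c * of_nat (Poly_Mapping.lookup m i))"
  by (cases "c = 0") (simp_all add: pdiff_def)

lemma pdiff_add: "pdiff i (p + q) = pdiff i p + pdiff i q"
  unfolding pdiff_def
  by (rule sum_keys_add[of "\<lambda>m c. Poly_Mapping.single (m - Poly_Mapping.single i 1)
        (c * of_nat (Poly_Mapping.lookup m i))"])
    (simp_all add: single_add algebra_simps)

lemma pdiff_mult: "pdiff i (p * q) = pdiff i p * q + p * pdiff i q"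
proof (induction p rule: mpoly_induct)
  case (single m c)
  show ?case
  proof (induction q rule: mpoly_induct)
    case (single m' c')
    let ?e = "Poly_Mapping.single i (Suc 0)"
    \<comment> \<open>Subtraction of exponents is truncated, so this shift needs x_i to occur in u;
      where it does not occur, the coefficient is zero anyway.\<close>
    have minus: "u + w - ?e = (u - ?e) + w" if "Poly_Mapping.lookup u i \<noteq> 0" for u w
      by (rule poly_mapping_eqI)
        (use that in \<open>auto simp: lookup_add lookup_minus lookup_single when_def\<close>)
    have "Poly_Mapping.single (m + m' - ?e) (c * c' * of_nat (Poly_Mapping.lookup m i)) =
        Poly_Mapping.single (m - ?e + m') (c * c' * of_nat (Poly_Mapping.lookup m i))"
      by (cases "Poly_Mapping.lookup m i = 0") (simp_all add: minus)
    moreover have "Poly_Mapping.single (m + m' - ?e) (c * c' * of_nat (Poly_Mapping.lookup m' i)) =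
        Poly_Mapping.single (m + (m' - ?e)) (c * c' * of_nat (Poly_Mapping.lookup m' i))"
      using minus[of m' m] by (cases "Poly_Mapping.lookup m' i = 0") (simp_all add: add.commute)
    ultimately show ?case
      by (simp add: mult_single pdiff_single lookup_add distrib_left single_add mult_ac add_ac)
  qed (simp add: pdiff_add algebra_simps)
qed (simp add: pdiff_add algebra_simps)

lemma pdiff_Const: "pdiff i (Const c) = 0"
  by (simp add: Const_def pdiff_single)

lemma pdiff_Var: "pdiff i (Var j) = (if i = j then 1 else 0)"
  by (simp add: Var_def pdiff_single lookup_single when_def)

locale derivation =
  fixes D :: "'k::comm_ring_1 mpoly \<Rightarrow> 'k mpoly"
  assumes D_add: "D (p + q) = D p + D q"
    and D_mult: "D (p * q) = D p * q + p * D q"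
    and D_Const [simp]: "D (Const c) = 0"
begin

lemma D_0 [simp]: "D 0 = 0" and D_1 [simp]: "D 1 = 0"
  using D_Const[of 0] D_Const[of 1] by (simp_all del: D_Const)

lemma D_Const_mult: "D (Const c * p) = Const c * D p"
  by (simp add: D_mult)

lemma D_minus: "D (- p) = - D p"
  using D_add[of p "- p"] by (simp add: eq_neg_iff_add_eq_0 add.commute)

lemma D_diff: "D (p - q) = D p - D q"
  using D_add[of p "- q"] by (simp add: D_minus)

lemma D_sum: "D (sum f S) = (\<Sum>x\<in>S. D (f x))"
  by (induction S rule: infinite_finite_induct) (simp_all add: D_add)

lemma D_power_eq_0: "D p = 0 \<Longrightarrow> D (p ^ k) = 0"
  by (induction k) (simp_all add: D_mult)

end

lemma derD_derivation: "derivation (derD n)"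
  by unfold_locales
    (simp_all add: derD_def pdiff_add pdiff_mult pdiff_Const sum.distrib sum_distrib_left
      sum_distrib_right distrib_left mult_ac)

lemma derD'_derivation: "derivation (derD' n)"
  by unfold_locales
    (simp_all add: derD'_def pdiff_add pdiff_mult pdiff_Const sum.distrib sum_distrib_left
      sum_distrib_right distrib_left mult_ac)

interpretation derD: derivation "derD n" for n
  by (rule derD_derivation)

interpretation derD': derivation "derD' n" for n
  by (rule derD'_derivation)

text \<open>The endpoint j = n fits the general formula because the factor n - n removes the stray
  \<open>Var (n + 1)\<close>; in \<open>derD'_Var\<close> the factor 1 - 1 likewise removes
  \<open>Var 0\<close>.\<close>

lemma derD_Var:
  "derD n (Var j) = (if j \<in> {1..n} then Const (of_nat (n - j)) * Var (j + 1) else 0)"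
proof -
  have "derD n (Var j) = (if j \<in> {1..n-1} then Const (of_nat (n - j)) * Var (j + 1) else 0)"
    by (simp add: derD_def pdiff_Var if_distrib[of "(*) _"] sum.delta del: of_nat_diff cong: if_cong)
  moreover have "j = n" if "j \<in> {1..n}" "j \<notin> {1..n-1}" using that by auto
  ultimately show ?thesis by (auto simp del: of_nat_diff)
qed

lemma derD'_Var:
  "derD' n (Var j) = (if j \<in> {1..n} then Const (of_nat (j - 1)) * Var (j - 1) else 0)"
proof -
  have "derD' n (Var j) = (if j \<in> {2..n} then Const (of_nat (j - 1)) * Var (j - 1) else 0)"
    by (simp add: derD'_def pdiff_Var if_distrib[of "(*) _"] sum.delta del: of_nat_diff cong: if_cong)
  moreover have "j = 1" if "j \<in> {1..n}" "j \<notin> {2..n}" using that by auto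
  ultimately show ?thesis by (auto simp del: of_nat_diff)
qed

section \<open>Shears\<close>

text \<open>The closed form of exp(cD): D x_j = (n-j) x_{j+1} gives D^i x_j = i! binom(n-j, i)
  x_{j+i}. The parameter is any ring element, so one formula covers substitutions, curves and the
  flow with an indeterminate as time.\<close>

definition shear :: "nat \<Rightarrow> 'a::comm_ring_1 \<Rightarrow> (nat \<Rightarrow> 'a) \<Rightarrow> nat \<Rightarrow> 'a" where
  "shear n c v j = (if j \<in> {1..n}
     then \<Sum>i\<le>n-j. of_nat ((n - j) choose i) * c ^ i * v (j + i) else v j)"

text \<open>Reversing the variables interchanges D and D'. Hence \<open>coshear\<close>, the
  conjugate of a shear by \<open>flip\<close>, is exp(tD'), and facts about D' can be read off from
  those about D.\<close>

definition flip :: "nat \<Rightarrow> (nat \<Rightarrow> 'a) \<Rightarrow> nat \<Rightarrow> 'a" where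
  "flip n v j = (if j \<in> {1..n} then v (n + 1 - j) else v j)"

definition coshear :: "nat \<Rightarrow> 'a::comm_ring_1 \<Rightarrow> (nat \<Rightarrow> 'a) \<Rightarrow> nat \<Rightarrow> 'a" where
  "coshear n t v = flip n (shear n t (flip n v))"

definition conj_act :: "nat \<Rightarrow> 'a::comm_ring_1 \<Rightarrow> 'a \<Rightarrow> (nat \<Rightarrow> 'a) \<Rightarrow> nat \<Rightarrow> 'a" where
  "conj_act n c t v = shear n (- c) (coshear n t (shear n c v))"

lemma flip_flip [simp]: "flip n (flip n v) = v"
  by (auto simp: flip_def fun_eq_iff)

text \<open>Grouped by the total shift s, the identity binom(N, i) binom(N-i, s-i) = binom(N, s)
  binom(s, i) leaves the binomial expansion of (c + d)^s.\<close>

lemma shear_shear: "shear n d (shear n c v) = shear n (c + d) v"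
proof
  fix j
  show "shear n d (shear n c v) j = shear n (c + d) v j"
  proof (cases "j \<in> {1..n}")
    case True
    let ?N = "n - j"
    let ?f = "\<lambda>i k. of_nat (?N choose i) * d ^ i * (of_nat ((?N - i) choose k) * c ^ k * v (j + i + k))"
    have "shear n d (shear n c v) j = (\<Sum>i\<le>?N. \<Sum>k\<le>?N - i. ?f i k)"
      using True by (auto simp: shear_def sum_distrib_left diff_diff_left intro!: sum.cong)
    also have "\<dots> = (\<Sum>(i, k)\<in>{(i, k). i + k \<le> ?N}. ?f i k)"
      by (subst sum.Sigma) (auto intro!: sum.cong)
    also have "\<dots> = (\<Sum>s\<le>?N. \<Sum>i\<le>s. ?f i (s - i))"
      by (rule sum.triangle_reindex_eq)
    also have "\<dots> = (\<Sum>s\<le>?N. of_nat (?N choose s) * (c + d) ^ s * v (j + s))"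
    proof (rule sum.cong, simp)
      fix s assume s: "s \<in> {..?N}"
      have ch: "(?N choose i) * ((?N - i) choose (s - i)) = (?N choose s) * (s choose i)" if "i \<le> s" for i
        using choose_mult[of i s ?N] s that by simp
      have "?f i (s - i) = of_nat (?N choose s) * v (j + s) * (of_nat (s choose i) * d ^ i * c ^ (s - i))"
        if "i \<le> s" for i
      proof -
        have "?f i (s - i) = of_nat ((?N choose i) * ((?N - i) choose (s - i))) *
            (d ^ i * c ^ (s - i) * v (j + s))"
          using that by (simp add: mult_ac)
        then show ?thesis unfolding ch[OF that] by (simp add: mult_ac)
      qed
      then have "(\<Sum>i\<le>s. ?f i (s - i)) =
          (\<Sum>i\<le>s. of_nat (?N choose s) * v (j + s) * (of_nat (s choose i) * d ^ i * c ^ (s - i)))"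
        by (intro sum.cong) auto
      also have "\<dots> = of_nat (?N choose s) * v (j + s) * (d + c) ^ s"
        by (simp only: binomial_ring sum_distrib_left)
      finally show "(\<Sum>i\<le>s. ?f i (s - i)) = of_nat (?N choose s) * (c + d) ^ s * v (j + s)"
        by (simp add: mult_ac add.commute)
    qed
    finally show ?thesis using True by (simp add: shear_def)
  next
    case False
    then show ?thesis by (simp only: shear_def if_False)
  qed
qed

lemma shear_0 [simp]: "shear n 0 v = v"
proof
  fix j
  have "(\<Sum>i\<le>n-j. of_nat ((n - j) choose i) * 0 ^ i * v (j + i)) = (\<Sum>i\<in>{0}. v (j + i))"
    by (rule sum.mono_neutral_cong_right) (auto simp: power_0_left)
  then show "shear n 0 v j = v j" by (simp add: shear_def)
qed

lemma coshear_coshear: "coshear n t (coshear n s v) = coshear n (s + t) v"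
  by (simp add: coshear_def shear_shear)

lemma coshear_0 [simp]: "coshear n 0 v = v"
  by (simp add: coshear_def)

lemma conj_act_conj_act: "conj_act n c t (conj_act n c s v) = conj_act n c (s + t) v"
  by (simp add: conj_act_def shear_shear coshear_coshear)

lemma conj_act_0 [simp]: "conj_act n c 0 v = v"
  by (simp add: conj_act_def shear_shear)

lemma coshear_eq:
  assumes "j \<in> {1..n}"
  shows "coshear n t v j = (\<Sum>i\<le>j-1. of_nat ((j - 1) choose i) * t ^ i * v (j - i))"
proof -
  have "coshear n t v j = (\<Sum>i\<le>j-1. of_nat ((j - 1) choose i) * t ^ i * flip n v (n + 1 - j + i))"
    using assms by (auto simp: coshear_def flip_def[of n "shear n t _"] shear_def)
  also have "\<dots> = (\<Sum>i\<le>j-1. of_nat ((j - 1) choose i) * t ^ i * v (j - i))"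
    using assms by (intro sum.cong) (auto simp: flip_def intro!: arg_cong[of _ _ v])
  finally show ?thesis .
qed

lemma shear_add: "shear n c (\<lambda>j. v j + w j) j = shear n c v j + shear n c w j"
  by (simp add: shear_def sum.distrib algebra_simps)

text \<open>Linearity for a fixed parameter. With c frozen at f(v)^l, it allows a translation after
  the action to be moved before it.\<close>

lemma conj_act_add: "conj_act n c t (\<lambda>j. v j + w j) = (\<lambda>j. conj_act n c t v j + conj_act n c t w j)"
proof -
  have add: "shear n c (\<lambda>j. v j + w j) = (\<lambda>j. shear n c v j + shear n c w j)" for c and v w :: "nat \<Rightarrow> 'a"
    by (simp add: fun_eq_iff shear_add)
  have fl: "flip n (\<lambda>j. v j + w j) = (\<lambda>j. flip n v j + flip n w j)" for v w :: "nat \<Rightarrow> 'a"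
    by (simp add: fun_eq_iff flip_def)
  show ?thesis by (simp add: conj_act_def coshear_def add fl)
qed

lemma conj_act_scale: "conj_act n c t (\<lambda>j. s * v j) = (\<lambda>j. s * conj_act n c t v j)"
proof -
  have sc: "shear n c (\<lambda>j. s * v j) = (\<lambda>j. s * shear n c v j)" for c and v :: "nat \<Rightarrow> 'a"
    by (simp add: fun_eq_iff shear_def sum_distrib_left mult_ac)
  have fl: "flip n (\<lambda>j. s * v j) = (\<lambda>j. s * flip n v j)" for v :: "nat \<Rightarrow> 'a"
    by (simp add: fun_eq_iff flip_def)
  show ?thesis by (simp add: conj_act_def coshear_def sc fl)
qed

context scalar_hom
begin

lemma hom_shear: "h (shear n c v j) = shear n (h c) (\<lambda>i. h (v i)) j"
  by (simp add: shear_def hom_sum hom_mult hom_power)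

lemma hom_coshear: "h (coshear n c v j) = coshear n (h c) (\<lambda>i. h (v i)) j"
proof -
  have "(\<lambda>i. h (flip n u i)) = flip n (\<lambda>i. h (u i))" for u
    by (simp add: flip_def fun_eq_iff)
  moreover have "h (flip n u i) = flip n (\<lambda>i. h (u i)) i" for u i
    by (simp add: flip_def)
  ultimately show ?thesis by (simp add: coshear_def hom_shear)
qed

lemma hom_conj_act: "h (conj_act n c t v j) = conj_act n (h c) (h t) (\<lambda>i. h (v i)) j"
  by (simp add: conj_act_def hom_shear hom_coshear hom_minus)

end

section \<open>The invariant as an expression in quadratic forms\<close>

text \<open>All products have index sum p + q. Two vector arguments are kept so that the mixed terms
  of a form at v + w are expressible too.\<close>

definition qf :: "('k \<Rightarrow> 'a::comm_ring_1) \<Rightarrow> (nat \<Rightarrow> 'k) \<Rightarrow> nat \<Rightarrow> nat \<Rightarrow> nat \<Rightarrow>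
    (nat \<Rightarrow> 'a) \<Rightarrow> (nat \<Rightarrow> 'a) \<Rightarrow> 'a" where
  "qf h b p q R v w = (\<Sum>r\<le>R. h (b r) * v (p + r) * w (q - r))"

definition alt_binom :: "nat \<Rightarrow> nat \<Rightarrow> 'k::comm_ring_1" where
  "alt_binom N r = (-1) ^ r * of_nat (N choose r)"

text \<open>The coefficients that arise when D is applied to a form with coefficients
  \<open>alt_binom N\<close>. The value at 0 stands for binom(N, 0) - binom(N, -1).\<close>

definition alt_binom_diff :: "nat \<Rightarrow> nat \<Rightarrow> 'k::comm_ring_1" where
  "alt_binom_diff N r = (case r of 0 \<Rightarrow> 1
     | Suc s \<Rightarrow> (-1) ^ r * (of_nat (N choose r) - of_nat (N choose s)))"

lemma (in scalar_hom) ev_qf: "ev h v (qf Const b p q R Var Var) = qf h b p q R v v"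
  by (simp add: qf_def ev_sum ev_mult)

lemma qf_cong: "(\<And>r. r \<le> R \<Longrightarrow> b r = b' r) \<Longrightarrow> qf h b p q R v w = qf h b' p q R v w"
  by (simp add: qf_def)

lemma qf_0: "(\<And>r. r \<le> R \<Longrightarrow> h (b r) = 0) \<Longrightarrow> qf h b p q R v w = 0"
  by (simp add: qf_def)

text \<open>Vanishing end coefficients shrink the range of the variables without changing the index
  sum. This is how D of a form in x_1, ..., x_n becomes a form in x_2, ..., x_n.\<close>

lemma qf_drop_ends:
  assumes "h (b 0) = 0" "h (b (Suc (Suc R))) = 0"
  shows "qf h b p (Suc q) (Suc (Suc R)) v w = qf h (\<lambda>r. b (Suc r)) (Suc p) q R v w"
  unfolding qf_def by (subst sum.atMost_Suc_shift) (use assms in simp)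

lemma qf_symmetric:
  assumes "q = p + R" "\<forall>r\<le>R. b (R - r) = b r"
  shows "qf h b p q R w v = qf h b p q R v w"
  unfolding qf_def
  by (rule sum.reindex_bij_witness[of _ "\<lambda>r. R - r" "\<lambda>r. R - r"])
    (use assms in \<open>auto simp: mult_ac intro!: arg_cong2[of _ _ _ _ "(*)"] arg_cong[of _ _ v] arg_cong[of _ _ w]\<close>)

lemma qf_add:
  "qf h b p q R (\<lambda>j. v j + w j) (\<lambda>j. v' j + w' j) =
    qf h b p q R v v' + qf h b p q R v w' + qf h b p q R w v' + qf h b p q R w w'"
  by (simp add: qf_def sum.distrib algebra_simps)

lemma qf_scale:
  "qf h b p q R (\<lambda>j. s * v j) (\<lambda>j. t * w j) = s * t * qf h b p q R v w"
  by (simp add: qf_def sum_distrib_left mult_ac)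

text \<open>Leibniz rule sorted by r: coefficient r collects the left factor differentiated in
  summand r - 1 and the right factor differentiated in summand r. At r = 0 and r = R + 1 only one of
  the two exists.\<close>

lemma derD_qf:
  assumes "1 \<le> p" "p + R \<le> n" "q \<le> n" "R < q"
  shows "derD n (qf Const b p q R Var Var) =
    qf Const (\<lambda>r. (case r of 0 \<Rightarrow> 0 | Suc s \<Rightarrow> b s * of_nat (n - p - s)) +
      (if r \<le> R then b r * of_nat (n - q + r) else 0)) p (Suc q) (Suc R) Var Var"
proof -
  have "derD n (qf Const b p q R Var Var) =
      (\<Sum>r\<le>R. Const (b r * of_nat (n - p - r)) * Var (Suc (p + r)) * Var (q - r)) +
      (\<Sum>r\<le>R. Const (b r * of_nat (n - q + r)) * Var (p + r) * Var (Suc q - r))"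
    unfolding qf_def derD.D_sum sum.distrib[symmetric]
  proof (rule sum.cong[OF refl])
    fix r assume r: "r \<in> {..R}"
    then have e: "n - (p + r) = n - p - r" "n - (q - r) = n - q + r" "Suc q - r = Suc (q - r)"
      using assms by auto
    have "p + r \<in> {1..n}" "q - r \<in> {1..n}" using r assms by auto
    then have d: "derD n (Var (p + r)) = Const (of_nat (n - p - r)) * Var (Suc (p + r))"
      "derD n (Var (q - r)) = Const (of_nat (n - q + r)) * Var (Suc q - r)"
      unfolding derD_Var e by (simp_all only: if_True) simp_all
    show "derD n (Const (b r) * Var (p + r) * Var (q - r)) =
        Const (b r * of_nat (n - p - r)) * Var (Suc (p + r)) * Var (q - r) +
        Const (b r * of_nat (n - q + r)) * Var (p + r) * Var (Suc q - r)"
      unfolding derD.D_mult derD.D_Const Const_mult d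
      by (simp add: algebra_simps del: of_nat_diff Const.hom_of_nat)
  qed
  also have "(\<Sum>r\<le>R. Const (b r * of_nat (n - p - r)) * Var (Suc (p + r)) * Var (q - r)) =
      (\<Sum>r\<le>Suc R. Const (case r of 0 \<Rightarrow> 0 | Suc s \<Rightarrow> b s * of_nat (n - p - s)) * Var (p + r) * Var (Suc q - r))"
    by (simp add: sum.atMost_Suc_shift del: sum.atMost_Suc)
  also have "(\<Sum>r\<le>R. Const (b r * of_nat (n - q + r)) * Var (p + r) * Var (Suc q - r)) =
      (\<Sum>r\<le>Suc R. Const (if r \<le> R then b r * of_nat (n - q + r) else 0) * Var (p + r) * Var (Suc q - r))"
    by simp
  finally show ?thesis
    unfolding qf_def Const_add distrib_right sum.distrib .
qed

lemma binom_step: "of_nat (N - s) * of_nat (N choose s) = of_nat (Suc s) * (of_nat (N choose Suc s) :: 'k::comm_ring_1)"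
  using binomial_absorb_comp[of N s] binomial_absorption[of s N]
  by (metis of_nat_mult)

text \<open>The two Leibniz contributions have opposite signs and agree by (N-s) binom(N, s) = (s+1)
  binom(N, s+1). With p = 1 this serves odd n, with p = 2 the form q2 for even n.\<close>

lemma derD_qf_alt_binom:
  assumes "1 \<le> p" "p \<le> n"
  shows "derD n (qf Const (alt_binom (n - p)) p n (n - p) Var Var) = 0"
proof -
  have "(case r of 0 \<Rightarrow> 0 | Suc s \<Rightarrow> alt_binom (n - p) s * of_nat (n - p - s)) +
      (if r \<le> n - p then alt_binom (n - p) r * of_nat (n - n + r) else 0) = (0 :: 'a)" for r
  proof (cases r)
    case (Suc s)
    have "of_nat (n - p choose s) * of_nat (n - p - s) = (of_nat (n - p choose Suc s) * of_nat (Suc s) :: 'a)"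
      using binom_step[of "n - p" s, where 'k = 'a] by (simp only: mult.commute)
    then show ?thesis
      unfolding Suc by (simp add: alt_binom_def mult.assoc not_le binomial_eq_0 del: of_nat_diff of_nat_Suc)
  qed simp
  then show ?thesis
    by (subst derD_qf) (use assms in \<open>auto intro!: qf_0\<close>)
qed

text \<open>Here the form, q0, ends at x_{n-1}, so both Leibniz factors are one larger than in the
  cancelling case. The surplus leaves differences of neighbouring binomials: D q0 = q1.\<close>

lemma derD_qf_lower:
  assumes n: "n = Suc (Suc N)"
  shows "derD n (qf Const (alt_binom N) 1 (Suc N) N Var Var) =
    (qf Const (alt_binom_diff N) 1 n (Suc N) Var Var :: 'k::comm_ring_1 mpoly)"
proof -
  have "(case r of 0 \<Rightarrow> 0 | Suc s \<Rightarrow> alt_binom N s * of_nat (n - 1 - s)) +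
      (if r \<le> N then alt_binom N r * of_nat (n - Suc N + r) else 0) = (alt_binom_diff N r :: 'k)"
    if "r \<le> Suc N" for r
  proof (cases r)
    case (Suc s)
    with that have s: "n - 1 - s = Suc (N - s)" "n - Suc s = Suc (N - s)" using n by auto
    have alg: "e * A * (1 + a) + - (e * B) * (2 + u) = - (e * (B - A))"
      if "A * a = B * (1 + u)" for A B a u e :: 'k
    proof -
      have "e * A * (1 + a) + - (e * B) * (2 + u) = e * A + e * (A * a) - e * B - e * (B * (1 + u))"
        by (simp add: algebra_simps)
      also have "\<dots> = - (e * (B - A))"
        unfolding that by (simp add: algebra_simps)
      finally show ?thesis .
    qed
    have "of_nat (N choose s) * of_nat (N - s) = (of_nat (N choose Suc s) * (1 + of_nat s) :: 'k)"
      using binom_step[of N s, where 'k = 'k] by (simp only: mult.commute of_nat_Suc)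
    note alg[OF this, of "(-1) ^ s"]
    moreover have "(if Suc s \<le> N then alt_binom N (Suc s) * of_nat (n - Suc N + Suc s) else 0) =
        (alt_binom N (Suc s) * (2 + of_nat s) :: 'k)"
      by (simp add: n alt_binom_def not_le binomial_eq_0)
    ultimately show ?thesis
      unfolding Suc by (simp add: s alt_binom_def alt_binom_diff_def mult.assoc del: of_nat_diff)
  qed (simp add: n alt_binom_def alt_binom_diff_def)
  then show ?thesis
    by (subst derD_qf) (auto simp: n intro!: qf_cong)
qed

text \<open>The second link of the chain D q0 = q1, D q1 = 2 q2, D q2 = 0. The end coefficients
  vanish and the inner ones collapse to twice a signed binomial.\<close>

lemma derD_qf_middle:
  assumes n: "n = Suc (Suc N)"
  shows "derD n (qf Const (alt_binom_diff N) 1 n (Suc N) Var Var) =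
    (Const 2 * qf Const (alt_binom N) 2 n N Var Var :: 'k::comm_ring_1 mpoly)"
proof -
  define b :: "nat \<Rightarrow> 'k" where
    "b r = (case r of 0 \<Rightarrow> 0 | Suc s \<Rightarrow> alt_binom_diff N s * of_nat (n - 1 - s)) +
      (if r \<le> Suc N then alt_binom_diff N r * of_nat (n - n + r) else 0)" for r
  have b: "b (Suc s) = 2 * alt_binom N s" if "s \<le> N" for s
  proof (cases s)
    case 0
    then show ?thesis by (simp add: b_def n alt_binom_def alt_binom_diff_def algebra_simps)
  next
    case (Suc t)
    with that have s: "Suc t \<le> N" "N - t = Suc (N - Suc t)" by auto
    \<comment> \<open>A, B, C are to be the binomials of N over t, t + 1 and t + 2, tied together by
      two instances of \<open>binom_step\<close>.\<close>
    have alg: "- (e * (B - A)) * (1 + a) + e * (C - B) * (2 + u) = 2 * - (e * B)"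
      if "A * (1 + a) = B * (1 + u)" "B * a = C * (2 + u)" for A B C a u e :: 'k
    proof -
      have "- (e * (B - A)) * (1 + a) + e * (C - B) * (2 + u) =
          e * (A * (1 + a)) - e * B - e * (B * a) + e * (C * (2 + u)) - e * (B * (2 + u))"
        by (simp add: algebra_simps)
      also have "\<dots> = 2 * - (e * B)"
        unfolding that(1) that(2)[symmetric] by (simp add: algebra_simps)
      finally show ?thesis .
    qed
    have "of_nat (N choose t) * of_nat (N - t) = (of_nat (N choose Suc t) * of_nat (Suc t) :: 'k)"
      "of_nat (N choose Suc t) * of_nat (N - Suc t) = (of_nat (N choose Suc (Suc t)) * of_nat (Suc (Suc t)) :: 'k)"
      using binom_step[of N t, where 'k = 'k] binom_step[of N "Suc t", where 'k = 'k]
      by (simp_all only: mult.commute)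
    then have "- ((-1) ^ t * (of_nat (N choose Suc t) - of_nat (N choose t))) * (1 + of_nat (N - Suc t)) +
        (-1) ^ t * (of_nat (N choose Suc (Suc t)) - of_nat (N choose Suc t)) * (2 + of_nat t) =
        (2 * - ((-1) ^ t * of_nat (N choose Suc t)) :: 'k)"
      unfolding s(2) of_nat_Suc by (intro alg) (simp_all add: add.assoc del: of_nat_diff)
    moreover have "b (Suc (Suc t)) = alt_binom_diff N (Suc t) * (1 + of_nat (N - Suc t)) +
        alt_binom_diff N (Suc (Suc t)) * (2 + of_nat t)"
      using s by (simp add: b_def n del: of_nat_diff)
    ultimately show ?thesis
      unfolding Suc by (simp add: alt_binom_def alt_binom_diff_def mult.assoc del: of_nat_diff)
  qed
  have "derD n (qf Const (alt_binom_diff N) 1 n (Suc N) Var Var) = qf Const b 1 (Suc n) (Suc (Suc N)) Var Var"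
    by (subst derD_qf) (auto simp: n b_def intro!: qf_cong)
  also have "\<dots> = qf Const (\<lambda>r. b (Suc r)) 2 n N Var Var"
    by (subst qf_drop_ends) (auto simp: b_def n numeral_2_eq_2)
  also have "\<dots> = Const 2 * qf Const (alt_binom N) 2 n N Var Var"
    unfolding qf_def sum_distrib_left
    by (rule sum.cong) (auto simp: b Const_mult mult.assoc simp del: Const.hom_numeral)
  finally show ?thesis .
qed

lemma f_odd_eq:
  assumes "1 \<le> m"
  shows "f_odd m = Const (1/2) * qf Const (alt_binom (2*m-2)) 1 (2*m-1) (2*m-2) Var Var"
proof -
  have "(\<Sum>i=1..2*m-1. Const ((-1) ^ (i - 1) * of_nat ((2*m-2) choose (i - 1))) * Var i * Var (2*m - i)) =
      (qf Const (alt_binom (2*m-2)) 1 (2*m-1) (2*m-2) Var Var :: 'a mpoly)"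
    unfolding qf_def
    by (rule sum.reindex_bij_witness[of _ Suc "\<lambda>i. i - 1"])
      (use assms in \<open>auto simp: alt_binom_def\<close>)
  then show ?thesis by (simp add: f_odd_def)
qed

lemma f_n_odd:
  assumes "odd n"
  shows "Const 2 * f_n n = (qf Const (alt_binom (n - 1)) 1 n (n - 1) Var Var :: 'k::field_char_0 mpoly)"
proof -
  obtain k where n: "n = Suc (2 * k)" using assms by (auto elim: oddE)
  have "Const 2 * Const (1/2) = (1 :: 'k mpoly)"
    by (simp flip: Const_mult del: Const.hom_numeral)
  then show ?thesis
    by (simp add: n f_n_def f_odd_eq mult.assoc[symmetric] del: Const.hom_numeral)
qed

text \<open>So f is a quarter of the discriminant of q0 X^2 + q1 X + q2; the factor 4 absorbs the
  halves that come from \<open>f_odd\<close>.\<close>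

lemma f_n_even:
  assumes n: "n = Suc (Suc N)" and "even n"
  shows "Const 4 * f_n n = (qf Const (alt_binom_diff N) 1 n (Suc N) Var Var ^ 2 -
    Const 4 * qf Const (alt_binom N) 2 n N Var Var * qf Const (alt_binom N) 1 (Suc N) N Var Var
    :: 'k::field_char_0 mpoly)"
proof -
  let ?q0 = "qf Const (alt_binom N) 1 (Suc N) N Var Var :: 'k mpoly"
  let ?q1 = "qf Const (alt_binom_diff N) 1 n (Suc N) Var Var :: 'k mpoly"
  let ?q2 = "qf Const (alt_binom N) 2 n N Var Var :: 'k mpoly"
  define c :: "'k mpoly" where "c = Const (1/2)"
  have c: "2 * c = 1" unfolding c_def by (subst Const.hom_numeral[symmetric]) (simp flip: Const_mult del: Const.hom_numeral)
  obtain k where k: "N = 2 * k" using assms by (auto elim: evenE)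
  have f: "f_odd (n div 2) = c * ?q0"
    by (subst f_odd_eq) (auto simp: n k c_def)
  have d1: "derD n (f_odd (n div 2)) = c * ?q1"
    unfolding f c_def derD.D_Const_mult derD_qf_lower[OF n] ..
  have d2: "derD n (derD n (f_odd (n div 2))) = ?q2"
    unfolding d1 unfolding c_def derD.D_Const_mult derD_qf_middle[OF n]
    using c by (simp add: c_def mult.assoc[symmetric] mult.commute)
  have f_n: "f_n n = (c * ?q1)^2 - Const 2 * ?q2 * (c * ?q0)"
    using \<open>even n\<close> unfolding f_n_def d2 unfolding d1 unfolding f by simp
  have "Const 4 * f_n n = (2 * c * ?q1)^2 - 4 * ?q2 * (2 * c * ?q0)"
    unfolding f_n by (simp add: power_mult_distrib algebra_simps)
  then show ?thesis by (simp add: c)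
qed

text \<open>For even n the chain q0, q1, 2 q2, 0 under D gives D(q1^2 - 4 q2 q0) = 4 q1 q2 - 4 q2 q1
  = 0.\<close>

lemma derD_f_n:
  assumes "n \<ge> 3"
  shows "derD n (f_n n :: 'k::field_char_0 mpoly) = 0"
proof (cases "odd n")
  case True
  have "Const 2 * derD n (f_n n) = (0 :: 'k mpoly)"
    unfolding derD.D_Const_mult[symmetric] f_n_odd[OF True]
    by (rule derD_qf_alt_binom) (use assms in auto)
  then show ?thesis by simp
next
  case False
  obtain N where n: "n = Suc (Suc N)" using assms by (metis add_2_eq_Suc le_Suc_ex numeral_3_eq_3 add_Suc)
  have 2: "derD n (qf Const (alt_binom N) 2 n N Var Var) = (0 :: 'k mpoly)"
    using derD_qf_alt_binom[of 2 n, where 'a = 'k] n assms by simp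
  have "Const 4 * derD n (f_n n) = (0 :: 'k mpoly)"
    unfolding derD.D_Const_mult[symmetric] f_n_even[OF n False[simplified]]
    by (simp only: derD.D_diff power2_eq_square derD.D_mult derD.D_Const 2
        derD_qf_lower[OF n] derD_qf_middle[OF n]) simp
  then show ?thesis by simp
qed

section \<open>Invariance under shears\<close>

lemma hom_ev:
  assumes "scalar_hom g" "scalar_hom h"
  shows "g (ev h v p) = ev (\<lambda>c. g (h c)) (\<lambda>i. g (v i)) p"
proof -
  interpret g: scalar_hom g by fact
  interpret h: scalar_hom h by fact
  interpret gh: scalar_hom "\<lambda>c. g (h c)"
    by unfold_locales (simp_all add: g.hom_add h.hom_add g.hom_mult h.hom_mult)
  show ?thesis
    by (induction p rule: mpoly_ring_induct)
      (simp_all add: h.ev_add h.ev_mult gh.ev_add gh.ev_mult g.hom_add g.hom_mult)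
qed

lemma (in scalar_hom) scalar_hom_pCons: "scalar_hom (\<lambda>c. [:h c:])"
  by unfold_locales (simp_all add: hom_add hom_mult)

lemma scalar_hom_poly: "scalar_hom (\<lambda>p. poly p c)"
  by unfold_locales simp_all

text \<open>Chain rule along an integral curve V of the derivation: the hypothesis is the
  differential equation for the coordinates, and generators suffice.\<close>

lemma pderiv_ev:
  fixes h :: "'k::comm_ring_1 \<Rightarrow> 'a::idom"
  assumes "scalar_hom h" "derivation D"
    and V: "\<And>i. pderiv (V i) = ev (\<lambda>c. [:h c:]) V (D (Var i))"
  shows "pderiv (ev (\<lambda>c. [:h c:]) V p) = ev (\<lambda>c. [:h c:]) V (D p)"
proof -
  interpret h: scalar_hom h by fact
  interpret D: derivation D by fact
  interpret hX: scalar_hom "\<lambda>c. [:h c:]" by (rule h.scalar_hom_pCons)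
  show ?thesis
    by (induction p rule: mpoly_ring_induct)
      (simp_all add: V hX.ev_add hX.ev_mult D.D_add D.D_mult pderiv_add pderiv_mult pderiv_pCons algebra_simps)
qed

lemma pderiv_sum: "pderiv (sum f S) = (\<Sum>x\<in>S. pderiv (f x))"
  by (induction S rule: infinite_finite_induct) (simp_all add: pderiv_add)

lemma pderiv_shear:
  fixes v :: "nat \<Rightarrow> 'a::idom"
  assumes "j \<in> {1..n}"
  shows "pderiv (shear n [:0, 1:] (\<lambda>i. [:v i:]) j) =
    of_nat (n - j) * shear n [:0, 1:] (\<lambda>i. [:v i:]) (Suc j)"
proof (cases "n - j")
  case 0
  then show ?thesis using assms by (simp add: shear_def pderiv_pCons)
next
  case (Suc M)
  have X: "pderiv ([:0, 1:] ^ Suc i) = of_nat (Suc i) * [:0, 1:] ^ i" for i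
    by (simp add: pderiv_power_Suc pderiv_pCons of_nat_poly del: power_Suc of_nat_Suc)
  have M: "n - Suc j = M" "Suc j \<in> {1..n}" using Suc assms by auto
  have ch: "of_nat (Suc M choose Suc i) * of_nat (Suc i) = of_nat (Suc M) * (of_nat (M choose i) :: 'a poly)" for i
    using Suc_times_binomial_eq[of M i] by (metis of_nat_mult mult.commute)
  have t: "pderiv (of_nat k * [:0, 1:] ^ i * [:v m:]) = of_nat k * pderiv ([:0, 1:] ^ i) * [:v m:]" for k i m
    by (simp add: pderiv_mult pderiv_pCons of_nat_poly pderiv_smult)
  have "pderiv (shear n [:0, 1:] (\<lambda>i. [:v i:]) j) =
      (\<Sum>i\<le>Suc M. of_nat (Suc M choose i) * pderiv ([:0, 1:] ^ i) * [:v (j + i):])"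
    unfolding shear_def Suc using assms by (simp only: if_True pderiv_sum t)
  also have "\<dots> = (\<Sum>i\<le>M. of_nat (Suc M choose Suc i) * pderiv ([:0, 1:] ^ Suc i) * [:v (Suc j + i):])"
    by (subst sum.atMost_Suc_shift) (simp del: sum.atMost_Suc binomial_Suc_Suc power_Suc)
  also have "\<dots> = (\<Sum>i\<le>M. of_nat (Suc M) * (of_nat (M choose i) * [:0, 1:] ^ i * [:v (Suc j + i):]))"
    unfolding X mult.assoc[symmetric] ch ..
  also have "\<dots> = of_nat (n - j) * shear n [:0, 1:] (\<lambda>i. [:v i:]) (Suc j)"
    unfolding shear_def M(1) Suc using M(2) by (simp only: if_True sum_distrib_left)
  finally show ?thesis .
qed

text \<open>Along the flow with an indeterminate as time, p has derivative zero and is therefore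
  constant, by characteristic zero. Comparing the times c and 0 gives the claim.\<close>

lemma ev_shear_invariant:
  fixes h :: "'k::comm_ring_1 \<Rightarrow> 'a::{idom, ring_char_0}"
  assumes "scalar_hom h" "derD n p = 0"
  shows "ev h (shear n c v) p = ev h v p"
proof -
  interpret h: scalar_hom h by fact
  interpret hX: scalar_hom "\<lambda>c. [:h c:]" by (rule h.scalar_hom_pCons)
  interpret at: scalar_hom "\<lambda>q. poly q d" for d :: 'a by (rule scalar_hom_poly)
  define V where "V = shear n [:0, 1:] (\<lambda>i. [:v i:])"
  have "pderiv (V i) = ev (\<lambda>c. [:h c:]) V (derD n (Var i))" for i
  proof (cases "i \<in> {1..n}")
    case True
    then show ?thesis
      using pderiv_shear[OF True, of v]
      by (auto simp: derD_Var hX.ev_mult V_def[symmetric] simp del: of_nat_diff)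
  next
    case False
    then have "V i = [:v i:]" unfolding V_def shear_def by (simp only: if_False)
    then show ?thesis using False by (simp only: derD_Var if_False) (simp add: pderiv_pCons)
  qed
  then have "pderiv (ev (\<lambda>c. [:h c:]) V p) = 0"
    by (subst pderiv_ev[OF assms(1) derD_derivation[of n]]) (simp_all add: assms(2))
  then obtain a where a: "ev (\<lambda>c. [:h c:]) V p = [:a:]"
    by (metis pderiv_eq_0_iff degree_eq_zeroE)
  have "poly (ev (\<lambda>c. [:h c:]) V p) d = ev h (shear n d v) p" for d
    unfolding V_def hom_ev[OF at.scalar_hom_axioms hX.scalar_hom_axioms] at.hom_shear
    by simp
  from this[of c] this[of 0] show ?thesis by (simp add: a)
qed

lemma qf_flip:
  assumes "1 \<le> p" "p + R \<le> n" "q \<le> n" "R < q"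
  shows "qf h b p q R (flip n v) (flip n v) = qf h b (n + 1 - q) (n + 1 - p) R v v"
  unfolding qf_def
proof (rule sum.cong[OF refl])
  fix r assume "r \<in> {..R}"
  then have e: "p + r \<in> {1..n}" "q - r \<in> {1..n}" "n + 1 - (p + r) = n + 1 - p - r"
    "n + 1 - (q - r) = n + 1 - q + r"
    using assms by auto
  show "h (b r) * flip n v (p + r) * flip n v (q - r) = h (b r) * v (n + 1 - q + r) * v (n + 1 - p - r)"
    unfolding flip_def e(3,4) using e(1,2) by (simp only: if_True mult_ac)
qed

lemma ge3_Suc_Suc: "n \<ge> 3 \<Longrightarrow> n = Suc (Suc (n - 2))" for n :: nat
  by simp

lemma ev_f_n_odd:
  assumes "scalar_hom h" "odd n"
  shows "2 * ev h v (f_n n) = qf h (alt_binom (n - 1)) 1 n (n - 1) v v"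
proof -
  interpret scalar_hom h by fact
  show ?thesis using arg_cong[OF f_n_odd[OF assms(2)], of "ev h v"]
    by (simp add: ev_mult ev_qf)
qed

lemma ev_f_n_even:
  assumes "scalar_hom h" "n = Suc (Suc N)" "even n"
  shows "4 * ev h v (f_n n) = qf h (alt_binom_diff N) 1 n (Suc N) v v ^ 2 -
    4 * qf h (alt_binom N) 2 n N v v * qf h (alt_binom N) 1 (Suc N) N v v"
proof -
  interpret scalar_hom h by fact
  show ?thesis using arg_cong[OF f_n_even[OF assms(2,3)], of "ev h v"]
    by (simp add: ev_mult ev_qf ev_diff ev_power)
qed

text \<open>Reversal fixes q1 and swaps q0 with q2, so the discriminant is unchanged. Invariance
  under exp(tD') thereby follows from invariance under exp(tD).\<close>

lemma ev_f_n_flip: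
  fixes h :: "'k::field_char_0 \<Rightarrow> 'a::{idom, ring_char_0}"
  assumes "scalar_hom h" "n \<ge> 3"
  shows "ev h (flip n v) (f_n n) = ev h v (f_n n)"
proof (cases "odd n")
  case True
  have "2 * ev h (flip n v) (f_n n) = 2 * ev h v (f_n n)"
    unfolding ev_f_n_odd[OF assms(1) True] by (subst qf_flip) (use assms(2) in auto)
  then show ?thesis by simp
next
  case False
  obtain N where n: "n = Suc (Suc N)" using ge3_Suc_Suc[OF assms(2)] by blast
  have flips: "qf h b 1 n (Suc N) (flip n v) (flip n v) = qf h b 1 n (Suc N) v v"
    "qf h b 2 n N (flip n v) (flip n v) = qf h b 1 (Suc N) N v v"
    "qf h b 1 (Suc N) N (flip n v) (flip n v) = qf h b 2 n N v v" for b
    using qf_flip[of 1 "Suc N" n n h b v] qf_flip[of 2 N n n h b v] qf_flip[of 1 N n "Suc N" h b v]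
    by (simp_all add: n numeral_2_eq_2)
  have "4 * ev h (flip n v) (f_n n) = 4 * ev h v (f_n n)"
    unfolding ev_f_n_even[OF assms(1) n False[simplified]] flips by (simp add: mult_ac)
  then show ?thesis by simp
qed

lemma ev_f_n_shear:
  fixes h :: "'k::field_char_0 \<Rightarrow> 'a::{idom, ring_char_0}"
  assumes "scalar_hom h" "n \<ge> 3"
  shows "ev h (shear n c v) (f_n n) = ev h v (f_n n)"
  using assms by (intro ev_shear_invariant derD_f_n)

lemma ev_f_n_coshear:
  fixes h :: "'k::field_char_0 \<Rightarrow> 'a::{idom, ring_char_0}"
  assumes "scalar_hom h" "n \<ge> 3"
  shows "ev h (coshear n c v) (f_n n) = ev h v (f_n n)"
  using assms by (simp add: coshear_def ev_f_n_flip ev_f_n_shear)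

lemma ev_f_n_conj_act:
  fixes h :: "'k::field_char_0 \<Rightarrow> 'a::{idom, ring_char_0}"
  assumes "scalar_hom h" "n \<ge> 3"
  shows "ev h (conj_act n c t v) (f_n n) = ev h v (f_n n)"
  using assms by (simp add: conj_act_def ev_f_n_coshear ev_f_n_shear)

section \<open>Exponentials of cD and D' as shears\<close>

lemma lnd_exp_eq:
  assumes "E 0 = 0" "(E ^^ N) g = 0"
  shows "lnd_exp E g = (\<Sum>i<N. Const (1 / fact i) * (E ^^ i) g)"
proof -
  define L where "L = (LEAST N. (E ^^ N) g = 0)"
  have L: "(E ^^ L) g = 0" "L \<le> N"
    unfolding L_def using assms(2) by (auto intro: LeastI Least_le)
  have "(E ^^ i) g = 0" if "L \<le> i" for i
  proof -
    have "(E ^^ k) 0 = 0" for k by (induction k) (simp_all add: assms(1))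
    then show ?thesis
      using L(1) that by (metis le_add_diff_inverse2 funpow_add o_apply)
  qed
  then show ?thesis
    unfolding lnd_exp_def L_def[symmetric]
    by (intro sum.mono_neutral_left) (use L(2) in auto)
qed

lemma fact_binom_step: "fact i * (N choose i) * (N - i) = fact (Suc i) * (N choose Suc i)" for N :: nat
proof -
  have "Suc i * (N choose Suc i) = (N choose i) * (N - i)"
    using binomial_absorb_comp[of N i] binomial_absorption[of i N] by (simp only: mult.commute)
  moreover have "fact (Suc i) * (N choose Suc i) = fact i * (Suc i * (N choose Suc i))"
    by (simp only: fact_Suc of_nat_id mult_ac)
  ultimately show ?thesis by (simp only: mult.assoc)
qed

text \<open>As D c = 0, the powers of cD are c^i D^i, and the factorials in D^i x_j cancel against
  those of the exponential series.\<close>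

lemma exp_aut_derD:
  fixes c :: "'k::field_char_0 mpoly"
  assumes "derD n c = 0"
  shows "exp_aut n (\<lambda>g. c * derD n g) = shear n c Var"
proof
  fix j
  show "exp_aut n (\<lambda>g. c * derD n g) j = shear n c Var j"
  proof (cases "j \<in> {1..n}")
    case True
    define E where "E = (\<lambda>g. c * derD n g)"
    have E: "(E ^^ i) (Var j) = Const (of_nat (fact i * ((n - j) choose i))) * c ^ i * Var (j + i)" for i
    proof (induction i)
      case (Suc i)
      have "derD n ((E ^^ i) (Var j)) = c ^ i * Const (of_nat (fact (Suc i) * ((n - j) choose Suc i))) * Var (j + Suc i)"
      proof (cases "j + i \<le> n")
        case i: True
        then have "derD n (Var (j + i)) = Const (of_nat (n - j - i)) * (Var (j + Suc i) :: 'k mpoly)"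
          using \<open>j \<in> {1..n}\<close> by (subst derD_Var) (simp del: of_nat_diff)
        then show ?thesis
          unfolding Suc.IH fact_binom_step[symmetric] of_nat_mult Const_mult
          by (simp add: derD.D_mult derD.D_power_eq_0 assms mult_ac del: of_nat_diff Const.hom_of_nat)
      next
        case False
        then have z: "(n - j) choose i = 0" "(n - j) choose Suc i = 0"
          using True by (auto intro!: binomial_eq_0)
        show ?thesis unfolding Suc.IH z by simp
      qed
      then show ?case by (simp add: E_def mult_ac)
    qed simp
    have z: "(n - j) choose Suc (n - j) = 0" by (simp add: binomial_eq_0)
    have "lnd_exp E (Var j) = (\<Sum>i<Suc (n - j). Const (1 / fact i) * (E ^^ i) (Var j))"
      by (rule lnd_exp_eq) (simp add: E_def, unfold E z, simp)
    also have "\<dots> = (\<Sum>i\<le>n - j. of_nat ((n - j) choose i) * c ^ i * Var (j + i))"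
    proof (unfold lessThan_Suc_atMost, rule sum.cong[OF refl])
      fix i
      have "Const (1 / fact i) * Const (of_nat (fact i * ((n - j) choose i))) = (of_nat ((n - j) choose i) :: 'k mpoly)"
        unfolding Const_mult[symmetric] by simp
      then show "Const (1 / fact i) * (E ^^ i) (Var j) = of_nat ((n - j) choose i) * c ^ i * Var (j + i)"
        unfolding E mult.assoc[symmetric] by simp
    qed
    finally show ?thesis using True by (simp add: exp_aut_def shear_def E_def)
  qed (simp only: exp_aut_def shear_def if_False)
qed

lemma exp_aut_derD': "exp_aut n (derD' n) = (coshear n 1 Var :: nat \<Rightarrow> 'k::field_char_0 mpoly)"
proof
  fix j
  show "exp_aut n (derD' n) j = (coshear n 1 Var j :: 'k mpoly)"
  proof (cases "j \<in> {1..n}")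
    case True
    have E: "(derD' n ^^ i) (Var j) = Const (of_nat (fact i * ((j - 1) choose i))) * (Var (j - i) :: 'k mpoly)" for i
    proof (induction i)
      case (Suc i)
      have "derD' n ((derD' n ^^ i) (Var j)) =
          Const (of_nat (fact (Suc i) * ((j - 1) choose Suc i))) * (Var (j - Suc i) :: 'k mpoly)"
      proof (cases "i < j")
        case i: True
        have "derD' n (Var (j - i)) = Const (of_nat (j - 1 - i)) * (Var (j - Suc i) :: 'k mpoly)"
        proof -
          have "j - i \<in> {1..n}" "j - i - 1 = j - 1 - i" "j - i - 1 = j - Suc i" using True i by auto
          then show ?thesis by (simp only: derD'_Var if_True)
        qed
        then show ?thesis
          unfolding Suc.IH fact_binom_step[symmetric] of_nat_mult Const_mult
          by (simp add: derD'.D_mult mult_ac del: of_nat_diff Const.hom_of_nat)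
      next
        case False
        then have z: "(j - 1) choose i = 0" "(j - 1) choose Suc i = 0"
          using True by (auto intro!: binomial_eq_0)
        show ?thesis unfolding Suc.IH z by simp
      qed
      then show ?case by simp
    qed simp
    have z: "(j - 1) choose j = 0" using True by (intro binomial_eq_0) auto
    have "lnd_exp (derD' n) (Var j) = (\<Sum>i<j. Const (1 / fact i) * (derD' n ^^ i) (Var j :: 'k mpoly))"
      by (rule lnd_exp_eq) (simp, unfold E z, simp)
    also have "\<dots> = (\<Sum>i\<le>j-1. of_nat ((j - 1) choose i) * Var (j - i))"
    proof (rule sum.cong)
      show "{..<j} = {..j-1}" using True by auto
      fix i
      have "Const (1 / fact i) * Const (of_nat (fact i * ((j - 1) choose i))) = (of_nat ((j - 1) choose i) :: 'k mpoly)"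
        unfolding Const_mult[symmetric] by simp
      then show "Const (1 / fact i) * (derD' n ^^ i) (Var j) = (of_nat ((j - 1) choose i) * Var (j - i) :: 'k mpoly)"
        unfolding E mult.assoc[symmetric] by simp
    qed
    finally show ?thesis using True by (simp add: exp_aut_def coshear_eq)
  qed (simp only: exp_aut_def coshear_def shear_def flip_def if_False)
qed

section \<open>Powers of \<open>phi\<close>\<close>

definition point_map :: "('k::comm_ring_1 \<Rightarrow> 'a::comm_ring_1) \<Rightarrow> (nat \<Rightarrow> 'k mpoly) \<Rightarrow> (nat \<Rightarrow> 'a) \<Rightarrow> nat \<Rightarrow> 'a" where
  "point_map h phi v = (\<lambda>i. ev h v (phi i))"

lemma comp_aut_eq: "comp_aut phi psi = point_map Const psi phi"
  by (simp add: comp_aut_def subst_eq_ev point_map_def)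

text \<open>Passing from algebra maps to points reverses composition, so the leftmost factor of a
  word acts first on a point.\<close>

lemma point_map_comp_aut:
  assumes "scalar_hom h"
  shows "point_map h (comp_aut phi psi) v = point_map h psi (point_map h phi v)"
proof -
  interpret scalar_hom h by fact
  show ?thesis by (simp add: point_map_def comp_aut_def subst_eq_ev ev_ev)
qed

lemma point_map_shear:
  assumes "scalar_hom h"
  shows "point_map h (shear n c Var) v = shear n (ev h v c) v"
proof -
  interpret scalar_hom h by fact
  show ?thesis
    by (simp add: point_map_def fun_eq_iff scalar_hom.hom_shear[OF ev_scalar_hom])
qed

lemma point_map_coshear:
  assumes "scalar_hom h"
  shows "point_map h (coshear n c Var) v = coshear n (ev h v c) v"
proof -
  interpret scalar_hom h by fact
  show ?thesis
    by (simp add: point_map_def fun_eq_iff scalar_hom.hom_coshear[OF ev_scalar_hom])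
qed

lemma point_map_conj_act:
  assumes "scalar_hom h"
  shows "point_map h (conj_act n c t Var) v = conj_act n (ev h v c) (ev h v t) v"
proof -
  interpret scalar_hom h by fact
  show ?thesis
    by (simp add: point_map_def fun_eq_iff scalar_hom.hom_conj_act[OF ev_scalar_hom])
qed

text \<open>Substituting the first two factors into the coefficient -f^l of the third leaves it
  unchanged by invariance of f, so the outer shears have exactly opposite parameters.\<close>

lemma phi_map_eq:
  assumes "n \<ge> 3"
  shows "phi_map n l = (conj_act n (f_n n ^ l) 1 Var :: nat \<Rightarrow> 'k::field_char_0 mpoly)"
proof -
  let ?F = "f_n n ^ l :: 'k mpoly"
  note hom = Const.scalar_hom_axioms
  have D: "derD n ?F = 0" "derD n (- ?F) = 0"
    using derD_f_n[OF assms, where 'k = 'k] by (simp_all add: derD.D_power_eq_0 derD.D_minus)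
  have F: "ev Const (shear n ?F Var) ?F = ?F" "ev Const (coshear n c (shear n ?F Var)) ?F = ?F" for c
    by (simp_all add: Const.ev_power ev_f_n_shear[OF hom assms] ev_f_n_coshear[OF hom assms])
  have "phi_map n l = comp_aut (shear n ?F Var) (comp_aut (coshear n 1 Var) (shear n (- ?F) Var))"
    unfolding phi_map_def exp_aut_derD[OF D(1)] exp_aut_derD'
    using exp_aut_derD[OF D(2)] by simp
  also have "\<dots> = point_map Const (shear n (- ?F) Var) (coshear n 1 (shear n ?F Var))"
    unfolding comp_aut_eq point_map_comp_aut[OF hom, unfolded comp_aut_eq] point_map_coshear[OF hom]
    by simp
  also have "\<dots> = conj_act n ?F 1 Var"
    unfolding point_map_shear[OF hom] conj_act_def by (simp add: Const.ev_minus F)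
  finally show ?thesis .
qed

lemma comp_aut_conj_act:
  assumes "n \<ge> 3"
  shows "comp_aut (conj_act n (f_n n ^ l) (of_int s) Var) (conj_act n (f_n n ^ l) (of_int t) Var) =
    (conj_act n (f_n n ^ l) (of_int (s + t)) Var :: nat \<Rightarrow> 'k::field_char_0 mpoly)"
  unfolding comp_aut_eq point_map_conj_act[OF Const.scalar_hom_axioms]
  by (simp add: Const.ev_power ev_f_n_conj_act[OF Const.scalar_hom_axioms assms] conj_act_conj_act)

section \<open>Variables occurring in powers of \<open>phi_map\<close>, and inverses\<close>

lemma vars_add: 
  assumes "vars p \<subseteq> K" "vars q \<subseteq> K"
  shows "vars (p + q) \<subseteq> K"
proof
  fix x assume "x \<in> vars (p + q)"
  then obtain m where m: "m \<in> Poly_Mapping.keys (p + q)" "x \<in> Poly_Mapping.keys m"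
    unfolding vars_def by (rule UN_E)
  from subsetD[OF Poly_Mapping.keys_add m(1)]
  show "x \<in> K" using m(2) assms unfolding vars_def by auto
qed

lemma vars_mult:
  assumes "vars p \<subseteq> K" "vars q \<subseteq> K"
  shows "vars (p * q) \<subseteq> K"
proof
  fix x assume "x \<in> vars (p * q)"
  then obtain m where m: "m \<in> Poly_Mapping.keys (p * q)" "x \<in> Poly_Mapping.keys m"
    by (auto simp: vars_def)
  with keys_mult[of p q] obtain a b where ab: "m = a + b" "a \<in> Poly_Mapping.keys p" "b \<in> Poly_Mapping.keys q"
    by blast
  then have "x \<in> Poly_Mapping.keys a \<or> x \<in> Poly_Mapping.keys b"
    using m(2) Poly_Mapping.keys_add[of a b] by blast
  then show "x \<in> K" using ab assms by (auto simp: vars_def)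
qed

lemma vars_minus: "vars (- p) = vars p"
  by (simp add: vars_def in_keys_iff set_eq_iff)

lemma vars_diff: "vars p \<subseteq> K \<Longrightarrow> vars q \<subseteq> K \<Longrightarrow> vars (p - q) \<subseteq> K"
  using vars_add[of p K "- q"] by (simp add: vars_minus)

lemma vars_Const: "vars (Const c) = {}"
  by (cases "c = 0") (simp_all add: vars_def Const_def)

lemma vars_of_nat: "vars (of_nat k) = {}"
  using vars_Const[of "of_nat k"] by simp

lemma vars_1: "vars 1 = {}"
  using vars_of_nat[of 1] by simp

lemma vars_Var: "vars (Var i :: 'k::comm_ring_1 mpoly) = {i}"
  by (simp add: vars_def Var_def)

lemma vars_sum: "(\<And>x. x \<in> S \<Longrightarrow> vars (f x) \<subseteq> K) \<Longrightarrow> vars (sum f S) \<subseteq> K"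
proof (induction S rule: infinite_finite_induct)
  case (insert x S)
  then show ?case by (simp add: vars_add)
qed (simp_all add: vars_def)

lemma vars_power: "vars p \<subseteq> K \<Longrightarrow> vars (p ^ k) \<subseteq> K"
  by (induction k) (simp_all add: vars_1 vars_mult)

lemma vars_qf:
  assumes "1 \<le> p" "p + R \<le> n" "q \<le> n" "R < q"
  shows "vars (qf Const b p q R Var Var) \<subseteq> {1..n}"
  unfolding qf_def
  by (intro vars_sum vars_mult) (use assms in \<open>auto simp: vars_Const vars_Var\<close>)

lemma vars_f_n:
  assumes "n \<ge> 3"
  shows "vars (f_n n :: 'k::field_char_0 mpoly) \<subseteq> {1..n}"
proof (cases "odd n")
  case True
  have "f_n n = Const (1/2) * (Const 2 * f_n n :: 'k mpoly)"
    unfolding mult.assoc[symmetric] Const_mult[symmetric] by simp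
  also have "vars \<dots> \<subseteq> {1..n}"
    unfolding f_n_odd[OF True]
    by (intro vars_mult vars_qf) (use assms in \<open>auto simp: vars_Const\<close>)
  finally show ?thesis .
next
  case False
  obtain N where n: "n = Suc (Suc N)" using ge3_Suc_Suc[OF assms] by blast
  have "f_n n = Const (1/4) * (Const 4 * f_n n :: 'k mpoly)"
    unfolding mult.assoc[symmetric] Const_mult[symmetric] by simp
  also have "vars \<dots> \<subseteq> {1..n}"
    unfolding f_n_even[OF n False[simplified]]
    by (intro vars_mult vars_diff vars_power vars_qf)
      (use assms n in \<open>auto simp: vars_Const simp del: Const.hom_numeral\<close>)
  finally show ?thesis .
qed

lemma vars_shear:
  assumes "vars c \<subseteq> {1..n}" "\<And>i. i \<in> {1..n} \<Longrightarrow> vars (v i) \<subseteq> {1..n}" "j \<in> {1..n}"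
  shows "vars (shear n c v j) \<subseteq> {1..n}"
proof -
  have "vars (v (j + i)) \<subseteq> {1..n}" if "i \<in> {..n - j}" for i
    by (rule assms(2)) (use that assms(3) in auto)
  then show ?thesis
    unfolding shear_def if_P[OF assms(3)]
    by (intro vars_sum vars_mult vars_power assms(1)) (simp_all add: vars_of_nat)
qed

lemma vars_flip:
  assumes "\<And>i. i \<in> {1..n} \<Longrightarrow> vars (v i) \<subseteq> {1..n}" "j \<in> {1..n}"
  shows "vars (flip n v j) \<subseteq> {1..n}"
  unfolding flip_def if_P[OF assms(2)] by (rule assms(1)) (use assms(2) in auto)

lemma normalized_conj_act:
  assumes "vars c \<subseteq> {1..n}" "vars t \<subseteq> {1..n}"
  shows "normalized n (conj_act n c t Var)"
proof -
  have "conj_act n c t Var i = Var i" if "i \<notin> {1..n}" for i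
    using that by (simp only: conj_act_def coshear_def shear_def flip_def if_False)
  moreover have "vars (conj_act n c t Var i) \<subseteq> {1..n}" if "i \<in> {1..n}" for i
    unfolding conj_act_def coshear_def
    by (intro vars_shear vars_flip) (use that assms in \<open>simp_all add: vars_minus vars_Var\<close>)
  ultimately show ?thesis unfolding normalized_def by blast
qed

text \<open>The definite description in \<open>aut_inv\<close> needs uniqueness: a left inverse psi'
  composed with phi and psi equals both psi' and psi. Its normalization clause is the reason for
  tracking variables.\<close>

lemma aut_inv_eqI:
  assumes "normalized n psi" "comp_aut phi psi = Var" "comp_aut psi phi = Var"
  shows "aut_inv n phi = psi"
  unfolding aut_inv_def
proof (rule the_equality)
  fix psi' assume "normalized n psi' \<and> comp_aut phi psi' = Var \<and> comp_aut psi' phi = Var"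
  then show "psi' = psi"
    using comp_aut_assoc[of psi' phi psi] assms by simp
qed (use assms in blast)

lemma aut_pow_phi_map:
  assumes "n \<ge> 3"
  shows "aut_pow n (phi_map n l) i = (conj_act n (f_n n ^ l) (of_int i) Var :: nat \<Rightarrow> 'k::field_char_0 mpoly)"
proof -
  let ?c = "\<lambda>i. conj_act n (f_n n ^ l) (of_int i) Var :: nat \<Rightarrow> 'k mpoly"
  note comp = comp_aut_conj_act[OF assms, of l, where 'k = 'k]
  have phi: "phi_map n l = ?c 1" by (simp add: phi_map_eq[OF assms])
  have "normalized n (?c (- 1))"
    by (rule normalized_conj_act[OF vars_power[OF vars_f_n[OF assms]]]) (simp add: vars_minus vars_1)
  then have inv: "aut_inv n (?c 1) = ?c (- 1)"
    using comp[of 1 "- 1"] comp[of "- 1" 1] by (intro aut_inv_eqI) simp_all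
  have pow: "(comp_aut (?c s) ^^ k) Var = ?c (int k * s)" for s k
  proof (induction k)
    case (Suc k)
    have "(comp_aut (?c s) ^^ Suc k) Var = comp_aut (?c s) (?c (int k * s))"
      by (simp only: funpow.simps o_apply Suc.IH)
    also have "\<dots> = ?c (s + int k * s)" by (rule comp)
    also have "s + int k * s = int (Suc k) * s" by (simp add: algebra_simps)
    finally show ?case .
  qed simp
  show ?thesis unfolding aut_pow_def phi inv pow by simp
qed

lemma point_map_tau:
  assumes "scalar_hom h"
  shows "point_map h (tau n a) v = (\<lambda>j. if j \<in> {1..n} then v j + h (a j) else v j)"
proof -
  interpret scalar_hom h by fact
  show ?thesis by (auto simp: point_map_def tau_def fun_eq_iff ev_add)
qed

lemma point_map_phi_pow:
  fixes h :: "'k::field_char_0 \<Rightarrow> 'a::{idom, ring_char_0}"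
  assumes "scalar_hom h" "n \<ge> 3"
  shows "point_map h (aut_pow n (phi_map n l) i) v = conj_act n (ev h v (f_n n) ^ l) (of_int i) v"
proof -
  interpret scalar_hom h by fact
  show ?thesis
    unfolding aut_pow_phi_map[OF assms(2)] point_map_conj_act[OF assms(1)] by (simp add: ev_power)
qed

section \<open>Degrees under conjugated shears\<close>

text \<open>Phrased by coefficients so that the zero polynomial meets every bound;
  \<open>deg_less p 0\<close> forces p = 0, and \<open>deg_less p (Suc e)\<close> says that the
  degree is at most e.\<close>

definition deg_less :: "'a::zero poly \<Rightarrow> nat \<Rightarrow> bool" where
  "deg_less p e \<longleftrightarrow> (\<forall>k\<ge>e. coeff p k = 0)"

definition has_degree :: "'a::zero poly \<Rightarrow> nat \<Rightarrow> bool" where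
  "has_degree p e \<longleftrightarrow> p \<noteq> 0 \<and> degree p = e"

lemma deg_less_mono: "deg_less p e \<Longrightarrow> e \<le> e' \<Longrightarrow> deg_less p e'"
  by (auto simp: deg_less_def)

lemma deg_less_0 [simp]: "deg_less 0 e"
  by (simp add: deg_less_def)

lemma deg_less_degree: "degree p < e \<Longrightarrow> deg_less p e"
  by (auto simp: deg_less_def intro: coeff_eq_0)

lemma has_degree_less: "has_degree p e \<Longrightarrow> e < e' \<Longrightarrow> deg_less p e'"
  by (auto simp: has_degree_def intro: deg_less_degree)

lemma deg_less_add: "deg_less p e \<Longrightarrow> deg_less q e \<Longrightarrow> deg_less (p + q) e"
  by (simp add: deg_less_def)

lemma deg_less_diff: "deg_less p e \<Longrightarrow> deg_less q e \<Longrightarrow> deg_less (p - q) e"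
  for p q :: "'a::ab_group_add poly"
  by (simp add: deg_less_def)

lemma deg_less_sum: "(\<And>i. i \<in> S \<Longrightarrow> deg_less (f i) e) \<Longrightarrow> deg_less (sum f S) e"
  by (simp add: deg_less_def coeff_sum)

lemma deg_less_mult:
  assumes "deg_less p (Suc a)" "deg_less q (Suc b)" "a + b < e"
  shows "deg_less (p * q :: 'a::comm_semiring_0 poly) e"
  unfolding deg_less_def coeff_mult
proof (intro allI impI sum.neutral ballI)
  fix k i assume "e \<le> k" "i \<in> {..k}"
  then have "Suc a \<le> i \<or> Suc b \<le> k - i" using assms(3) by auto
  then show "coeff p i * coeff q (k - i) = 0"
    using assms by (auto simp: deg_less_def)
qed

lemma has_degree_add:
  assumes "has_degree p e" "deg_less q e"
  shows "has_degree (p + q) e"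
proof -
  have "coeff (p + q) e \<noteq> 0"
    using assms by (auto simp: has_degree_def deg_less_def)
  moreover have "coeff (p + q) k = 0" if "k > e" for k
    using assms that by (auto simp: has_degree_def deg_less_def coeff_eq_0)
  ultimately show ?thesis
    unfolding has_degree_def
    by (metis coeff_0 degree_le le_antisym le_degree)
qed

lemma has_degree_sum:
  assumes "finite S" "i \<in> S" "has_degree (f i) e" "\<And>j. j \<in> S \<Longrightarrow> j \<noteq> i \<Longrightarrow> deg_less (f j) e"
  shows "has_degree (sum f S) e"
  unfolding sum.remove[OF assms(1,2)]
  by (rule has_degree_add) (use assms in \<open>auto intro: deg_less_sum\<close>)

lemma has_degree_mult:
  fixes p q :: "'a::idom poly"
  shows "has_degree p a \<Longrightarrow> has_degree q b \<Longrightarrow> has_degree (p * q) (a + b)"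
  by (auto simp: has_degree_def degree_mult_eq)

lemma has_degree_power:
  fixes p :: "'a::idom poly"
  shows "has_degree p a \<Longrightarrow> has_degree (p ^ k) (k * a)"
  by (auto simp: has_degree_def degree_power_eq)

lemma has_degree_of_nat: "k \<noteq> 0 \<Longrightarrow> has_degree (of_nat k :: 'a::{idom, ring_char_0} poly) 0"
  by (simp add: has_degree_def)

lemma has_degree_of_int: "k \<noteq> 0 \<Longrightarrow> has_degree (of_int k :: 'a::{idom, ring_char_0} poly) 0"
  by (simp add: has_degree_def)

lemma deg_less_of_nat: "deg_less (of_nat k :: 'a::comm_ring_1 poly) (Suc 0)"
  by (rule deg_less_degree) simp

lemma has_degree_minus: "has_degree p e \<Longrightarrow> has_degree (- p :: 'a::ab_group_add poly) e"
  by (simp add: has_degree_def)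

lemma has_degree_shear_term:
  fixes c :: "'a::{idom, ring_char_0} poly"
  assumes "has_degree c C" "has_degree p e" "k \<noteq> 0"
  shows "has_degree (of_nat k * c ^ i * p) (i * C + e)"
  using has_degree_mult[OF has_degree_mult[OF has_degree_of_nat[OF assms(3)] has_degree_power[OF assms(1)]] assms(2)]
  by simp

lemma deg_less_shear_term:
  fixes c :: "'a::{idom, ring_char_0} poly"
  assumes "has_degree c C" "deg_less p (Suc x)" "i * C + x < e"
  shows "deg_less (of_nat k * c ^ i * p) e"
proof -
  have "deg_less (c ^ i) (Suc (i * C))"
    using has_degree_power[OF assms(1)] by (rule has_degree_less) simp
  then have "deg_less (of_nat k * c ^ i) (Suc (i * C))"
    by (rule deg_less_mult[OF deg_less_of_nat]) simp
  then show ?thesis by (rule deg_less_mult[OF _ assms(2)]) (use assms(3) in simp)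
qed

text \<open>The common shape of a generic vector and of a constant vector after the first shear.\<close>

definition dominated :: "nat \<Rightarrow> nat \<Rightarrow> (nat \<Rightarrow> 'a::zero poly) \<Rightarrow> bool" where
  "dominated n e u \<longleftrightarrow> has_degree (u 1) e \<and> (\<forall>j\<in>{2..n}. deg_less (u j) e)"

text \<open>Raising the index by i gains iC and loses at most iP. As P < C, the longest shift,
  c^(n-1) v_n in component 1, beats every other summand in every component.\<close>

lemma dominated_shear:
  fixes c :: "'a::{idom, ring_char_0} poly"
  assumes "n \<ge> 1" "has_degree c C" "P < C"
    and v: "\<And>j. j \<in> {1..n} \<Longrightarrow> deg_less (v j) (Suc (d + (n - j) * P))" and "has_degree (v n) d"
  shows "dominated n (d + (n - 1) * C) (shear n c v)"
proof -
  have strict: "i * C + (d + m * P) < d + k * C" if "i + m \<le> k" "i < k" for i m k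
  proof -
    have "i * C + m * P < k * C"
    proof (cases "m = 0")
      case False
      have "i * C + m * P < i * C + m * C" using assms(3) False by simp
      also have "\<dots> \<le> k * C" using that by (simp flip: add_mult_distrib)
      finally show ?thesis .
    qed (use that assms(3) in simp)
    then show ?thesis by simp
  qed
  have "has_degree (shear n c v 1) (d + (n - 1) * C)"
  proof -
    have "has_degree (\<Sum>i\<le>n-1. of_nat ((n - 1) choose i) * c ^ i * v (1 + i)) (d + (n - 1) * C)"
    proof (rule has_degree_sum)
      show "n - 1 \<in> {..n-1}" by simp
      have "has_degree (of_nat ((n - 1) choose (n - 1)) * c ^ (n - 1) * v (1 + (n - 1))) ((n - 1) * C + d)"
        by (rule has_degree_shear_term) (use assms in auto)
      then show "has_degree (of_nat ((n - 1) choose (n - 1)) * c ^ (n - 1) * v (1 + (n - 1))) (d + (n - 1) * C)"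
        by (simp only: add.commute)
      fix i assume i: "i \<in> {..n-1}" "i \<noteq> n - 1"
      have "1 + i \<in> {1..n}" using i assms(1) by auto
      from deg_less_shear_term[OF assms(2) v[OF this] strict]
      show "deg_less (of_nat ((n - 1) choose i) * c ^ i * v (1 + i)) (d + (n - 1) * C)"
        using i by auto
    qed simp
    then show ?thesis using assms(1) by (simp add: shear_def)
  qed
  moreover have "deg_less (shear n c v j) (d + (n - 1) * C)" if j: "j \<in> {2..n}" for j
  proof -
    have "deg_less (of_nat ((n - j) choose i) * c ^ i * v (j + i)) (d + (n - 1) * C)" if "i \<in> {..n - j}" for i
    proof -
      have "j + i \<in> {1..n}" using that j by auto
      from deg_less_shear_term[OF assms(2) v[OF this] strict]
      show ?thesis using that j by auto
    qed
    then show ?thesis using j by (auto simp: shear_def intro!: deg_less_sum)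
  qed
  ultimately show ?thesis by (simp add: dominated_def)
qed

text \<open>With m the last index of a nonzero entry, c^(m-1) a_m in component 1 is the unique top
  term. For m = 1 the bound is 0, and the other components really are zero.\<close>

lemma dominated_shear_const:
  fixes c :: "'a::{idom, ring_char_0} poly"
  assumes "has_degree c C" "0 < C" "m \<in> {1..n}" "a m \<noteq> 0" "\<And>j. j > m \<Longrightarrow> a j = 0"
  shows "dominated n ((m - 1) * C) (shear n c (\<lambda>j. [:a j:]))"
proof -
  have const: "deg_less [:x:] (Suc 0)" for x :: 'a
    by (rule deg_less_degree) simp
  have small: "deg_less (of_nat k * c ^ i * [:a (j + i):]) ((m - 1) * C)" if "m \<noteq> 1 + i" "j \<ge> 1" for k i j
  proof (cases "i < m - 1")
    case True
    then have "i * C < (m - 1) * C" using assms(2) by simp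
    with deg_less_shear_term[OF assms(1) const] show ?thesis by simp
  next
    case False
    then show ?thesis using that by (simp add: assms(5))
  qed
  have small': "deg_less (of_nat k * c ^ i * [:a (j + i):]) ((m - 1) * C)" if "j \<ge> 2" for k i j
    using small[of i j k] that by (cases "m = 1 + i") (simp_all add: assms(5))
  have "has_degree (\<Sum>i\<le>n-1. of_nat ((n - 1) choose i) * c ^ i * [:a (1 + i):]) ((m - 1) * C)"
  proof (rule has_degree_sum)
    show "m - 1 \<in> {..n-1}" using assms(3) by auto
    have m: "1 + (m - 1) = m" using assms(3) by auto
    have "has_degree [:a m:] 0" using assms(4) by (simp add: has_degree_def)
    moreover have "(n - 1) choose (m - 1) \<noteq> 0" using assms(3) by (auto simp: binomial_eq_0_iff)
    ultimately show "has_degree (of_nat ((n - 1) choose (m - 1)) * c ^ (m - 1) * [:a (1 + (m - 1)):]) ((m - 1) * C)"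
      using has_degree_shear_term[OF assms(1), of "[:a m:]" 0] unfolding m by simp
    fix i assume "i \<noteq> m - 1"
    then show "deg_less (of_nat ((n - 1) choose i) * c ^ i * [:a (1 + i):]) ((m - 1) * C)"
      by (intro small) auto
  qed simp
  then have "has_degree (shear n c (\<lambda>j. [:a j:]) 1) ((m - 1) * C)"
    using assms(3) by (simp add: shear_def)
  moreover have "deg_less (shear n c (\<lambda>j. [:a j:]) j) ((m - 1) * C)" if "j \<in> {2..n}" for j
  proof -
    have "j \<in> {1..n}" using that by auto
    then show ?thesis
      unfolding shear_def if_P[OF \<open>j \<in> {1..n}\<close>] by (intro deg_less_sum small') (use that in auto)
  qed
  ultimately show ?thesis by (simp add: dominated_def)
qed

text \<open>The middle map spreads the dominating first component to all components with nonzero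
  constant factors, so all get exact degree e. In the last shear the summand with (-c)^(n-j) then
  dominates component j.\<close>

lemma has_degree_conj_act:
  fixes c s :: "'a::{idom, ring_char_0} poly"
  assumes u: "dominated n e (shear n c v)" and c: "has_degree c C" "0 < C" and s: "has_degree s 0"
    and j: "j \<in> {1..n}"
  shows "has_degree (conj_act n c s v j) (e + (n - j) * C)"
proof -
  define p where "p = coshear n s (shear n c v)"
  have p: "has_degree (p j) e" if "j \<in> {1..n}" for j
    unfolding p_def coshear_eq[OF that]
  proof (rule has_degree_sum)
    show "j - 1 \<in> {..j-1}" by simp
    have j: "j - (j - 1) = 1" using that by auto
    show "has_degree (of_nat ((j - 1) choose (j - 1)) * s ^ (j - 1) * shear n c v (j - (j - 1))) e"
      using has_degree_shear_term[OF s, of "shear n c v 1" e 1 "j - 1"] u unfolding j dominated_def by simp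
    fix i assume "i \<in> {..j-1}" "i \<noteq> j - 1"
    then have "j - i \<in> {2..n}" using that by auto
    then have d: "deg_less (shear n c v (j - i)) e" using u by (auto simp: dominated_def)
    have "deg_less (of_nat ((j - 1) choose i) * s ^ i) (Suc 0)"
      using deg_less_shear_term[OF s, of 1 0 i "Suc 0"] by (simp add: deg_less_degree)
    note s_i = this
    show "deg_less (of_nat ((j - 1) choose i) * s ^ i * shear n c v (j - i)) e"
    \<comment> \<open>The product rule works with bounds of the form \<open>Suc\<close>, so e = 0 is
      separate: there the component itself vanishes.\<close>
    proof (cases e)
      case 0
      then have "shear n c v (j - i) = 0" using d by (auto simp: deg_less_def intro: poly_eqI)
      then show ?thesis by simp
    next
      case (Suc e')
      then show ?thesis using deg_less_mult[OF s_i d[unfolded Suc], of e] by simp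
    qed
  qed simp
  have "has_degree (\<Sum>i\<le>n-j. of_nat ((n - j) choose i) * (- c) ^ i * p (j + i)) (e + (n - j) * C)"
  proof (rule has_degree_sum)
    show "n - j \<in> {..n-j}" by simp
    have n: "j + (n - j) = n" using j by auto
    show "has_degree (of_nat ((n - j) choose (n - j)) * (- c) ^ (n - j) * p (j + (n - j))) (e + (n - j) * C)"
      using has_degree_shear_term[OF has_degree_minus[OF c(1)] p, of n 1 "n - j"] j unfolding n
      by (simp add: add.commute)
    fix i assume i: "i \<in> {..n-j}" "i \<noteq> n - j"
    then have "i * C < (n - j) * C" using c(2) by simp
    moreover have "deg_less (p (j + i)) (Suc e)"
      by (rule has_degree_less[OF p]) (use i j in auto)
    ultimately show "deg_less (of_nat ((n - j) choose i) * (- c) ^ i * p (j + i)) (e + (n - j) * C)"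
      by (intro deg_less_shear_term[OF has_degree_minus[OF c(1)]]) auto
  qed simp
  then show ?thesis
    unfolding conj_act_def p_def[symmetric] using j by (simp add: shear_def)
qed

section \<open>Quadratic forms on curves of two different slopes\<close>

abbreviation const_poly :: "'k::comm_ring_1 \<Rightarrow> 'k poly" where
  "const_poly \<equiv> \<lambda>c. [:c:]"

lemma scalar_hom_const_poly: "scalar_hom const_poly"
  by unfold_locales simp_all

lemma deg_less_const [simp]: "deg_less [:c:] (Suc e)"
  by (rule deg_less_degree) simp

lemma deg_less_qf:
  fixes v w :: "nat \<Rightarrow> 'k::comm_ring_1 poly"
  assumes "\<And>r. r \<le> R \<Longrightarrow> deg_less (v (p + r)) (Suc (x r))"
    and "\<And>r. r \<le> R \<Longrightarrow> deg_less (w (q - r)) (Suc (y r))"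
    and "\<And>r. r \<le> R \<Longrightarrow> x r + y r < e"
  shows "deg_less (qf const_poly b p q R v w) e"
  unfolding qf_def
proof (rule deg_less_sum)
  fix r assume "r \<in> {..R}"
  then have r: "r \<le> R" by simp
  have "deg_less ([:b r:] * v (p + r)) (Suc (x r))"
    by (rule deg_less_mult[OF _ assms(1)[OF r]]) simp_all
  then show "deg_less ([:b r:] * v (p + r) * w (q - r)) e"
    by (rule deg_less_mult[OF _ assms(2)[OF r] assms(3)[OF r]])
qed

text \<open>v is the given curve, with slope at most P; w is the pulled-back constant vector, with
  exact slope C > P and last degree K.\<close>

locale two_scales =
  fixes n d P K C :: nat and v w :: "nat \<Rightarrow> 'k::field_char_0 poly"
  assumes n3: "3 \<le> n" and PC: "P < C"
    and v: "\<And>j. j \<in> {1..n} \<Longrightarrow> deg_less (v j) (Suc (d + (n - j) * P))"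
    and vn: "has_degree (v n) d"
    and w: "\<And>j. j \<in> {1..n} \<Longrightarrow> has_degree (w j) (K + (n - j) * C)"
begin

lemma w': "j \<in> {1..n} \<Longrightarrow> deg_less (w j) (Suc (K + (n - j) * C))"
  by (rule has_degree_less[OF w]) auto

lemma deg_less_qf_vw:
  assumes "1 \<le> p" "p + R \<le> n" "q \<le> n" "R < q"
    and "\<And>r. r \<le> R \<Longrightarrow> d + (n - (p + r)) * P + (K + (n - (q - r)) * C) < e"
  shows "deg_less (qf const_poly b p q R v w) e"
proof (rule deg_less_qf)
  fix r assume "r \<le> R"
  then show "deg_less (v (p + r)) (Suc (d + (n - (p + r)) * P))"
    and "deg_less (w (q - r)) (Suc (K + (n - (q - r)) * C))"
    by (intro v w'; use assms in auto)+
qed (use assms in auto)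

lemma deg_less_qf_vv:
  assumes "1 \<le> p" "p + R \<le> n" "q \<le> n" "R < q" "p + R = q"
    and "2 * d + (2 * n - p - q) * P < e"
  shows "deg_less (qf const_poly b p q R v v) e"
proof (rule deg_less_qf)
  fix r assume r: "r \<le> R"
  then show "deg_less (v (p + r)) (Suc (d + (n - (p + r)) * P))"
    and "deg_less (v (q - r)) (Suc (d + (n - (q - r)) * P))"
    by (intro v; use assms in auto)+
  have "(n - (p + r)) * P + (n - (q - r)) * P = (2 * n - p - q) * P"
    unfolding add_mult_distrib[symmetric] by (rule arg_cong[of _ _ "\<lambda>x. x * P"]) (use assms r in simp)
  then show "d + (n - (p + r)) * P + (d + (n - (q - r)) * P) < e"
    using assms by simp
qed

lemma deg_less_qf_ww:
  assumes "1 \<le> p" "p + R \<le> n" "q \<le> n" "R < q" "p + R = q"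
    and "2 * K + (2 * n - p - q) * C < e"
  shows "deg_less (qf const_poly b p q R w w) e"
proof (rule deg_less_qf)
  fix r assume r: "r \<le> R"
  then show "deg_less (w (p + r)) (Suc (K + (n - (p + r)) * C))"
    and "deg_less (w (q - r)) (Suc (K + (n - (q - r)) * C))"
    by (intro w'; use assms in auto)+
  have "(n - (p + r)) * C + (n - (q - r)) * C = (2 * n - p - q) * C"
    unfolding add_mult_distrib[symmetric] by (rule arg_cong[of _ _ "\<lambda>x. x * C"]) (use assms r in simp)
  then show "K + (n - (p + r)) * C + (K + (n - (q - r)) * C) < e"
    using assms by simp
qed

text \<open>Summand r has degree at most d + (n-1-r)P + K + rC, strictly below the value attained by
  v_n w_1 at r = n - 1.\<close>

lemma has_degree_qf_vw:
  assumes "b (n - 1) \<noteq> 0"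
  shows "has_degree (qf const_poly b 1 n (n - 1) v w) (d + K + (n - 1) * C)"
  unfolding qf_def
proof (rule has_degree_sum)
  show "n - 1 \<in> {..n-1}" by simp
  have e: "1 + (n - 1) = n" "n - (n - 1) = 1" using n3 by auto
  have "has_degree [:b (n - 1):] 0" using assms by (simp add: has_degree_def)
  from has_degree_mult[OF has_degree_mult[OF this vn] w[of 1]]
  show "has_degree ([:b (n - 1):] * v (1 + (n - 1)) * w (n - (n - 1))) (d + K + (n - 1) * C)"
    unfolding e using n3 by (simp add: add.assoc)
  fix r assume r: "r \<in> {..n-1}" "r \<noteq> n - 1"
  have "1 + r \<in> {1..n}" "n - r \<in> {1..n}" and nr: "n - (n - r) = r" using r n3 by auto
  then have vr: "deg_less (v (1 + r)) (Suc (d + (n - (1 + r)) * P))" and wr: "deg_less (w (n - r)) (Suc (K + r * C))"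
    using v[of "1 + r"] w'[of "n - r"] by simp_all
  have le: "(n - (1 + r)) * P + r * C < (n - 1) * C"
  proof -
    have "(n - (1 + r)) * P < (n - (1 + r)) * C" using r PC by auto
    also have "(n - (1 + r)) * C + r * C = (n - 1) * C"
      unfolding add_mult_distrib[symmetric] using r by auto
    finally show ?thesis by simp
  qed
  have "deg_less ([:b r:] * v (1 + r)) (Suc (d + (n - (1 + r)) * P))"
    by (rule deg_less_mult[OF _ vr]) simp_all
  then show "deg_less ([:b r:] * v (1 + r) * w (n - r)) (d + K + (n - 1) * C)"
    by (rule deg_less_mult[OF _ wr]) (use le in simp)
qed simp

end

section \<open>Palindromic coefficients and expansion of the quartic\<close>

lemma alt_binom_symmetric: "even N \<Longrightarrow> \<forall>r\<le>N. alt_binom N (N - r) = alt_binom N r"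
  by (auto simp: alt_binom_def minus_one_power_iff binomial_symmetric[symmetric])

lemma alt_binom_diff_top: "even N \<Longrightarrow> alt_binom_diff N (Suc N) = 1"
  by (simp add: alt_binom_diff_def binomial_eq_0)

text \<open>Under r -> N + 1 - r with N even, both the sign and the difference of binomials change
  sign.\<close>

lemma alt_binom_diff_symmetric:
  assumes "even N"
  shows "\<forall>r\<le>Suc N. alt_binom_diff N (Suc N - r) = alt_binom_diff N r"
proof (intro allI impI)
  fix r assume r: "r \<le> Suc N"
  show "alt_binom_diff N (Suc N - r) = alt_binom_diff N r"
  proof (cases r)
    case 0
    then show ?thesis using alt_binom_diff_top[OF assms(1)] by (simp add: alt_binom_diff_def)
  next
    case (Suc s)
    with r have s: "s \<le> N" by simp
    show ?thesis
    proof (cases "N - s")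
      case 0
      with s have "s = N" by simp
      then show ?thesis using alt_binom_diff_top[OF assms(1)] by (simp add: Suc alt_binom_diff_def)
    next
      case t: (Suc t)
      have ts: "N - t = Suc s" using t s by linarith
      have e: "N choose Suc t = N choose s" "N choose t = N choose Suc s"
        using binomial_symmetric[of s N] binomial_symmetric[of t N] t s ts by simp_all
      have "N = s + Suc t" using t s by linarith
      then have "even (Suc t) \<longleftrightarrow> even s" using assms by (simp only: even_add)
      then show ?thesis
        using t by (cases "even s") (simp_all add: Suc alt_binom_diff_def e minus_one_power_iff)
    qed
  qed
qed

lemma qf_add_scale:
  assumes "q = p + R" "\<forall>r\<le>R. b (R - r) = b r"
  shows "qf h b p q R (\<lambda>j. x j + t * y j) (\<lambda>j. x j + t * y j) =
    qf h b p q R x x + 2 * t * qf h b p q R x y + t ^ 2 * qf h b p q R y y"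
proof -
  have "qf h b p q R x (\<lambda>j. t * y j) = t * qf h b p q R x y"
    "qf h b p q R (\<lambda>j. t * y j) x = t * qf h b p q R x y"
    using qf_scale[of h b p q R 1 x t y] qf_scale[of h b p q R t y 1 x] qf_symmetric[OF assms, of h y x] by simp_all
  then show ?thesis by (simp add: qf_add qf_scale power2_eq_square)
qed

lemma deg_less_numeral_mult: "deg_less p e \<Longrightarrow> deg_less (numeral k * p :: 'a::comm_ring_1 poly) e"
  by (simp add: numeral_poly deg_less_def)

lemma has_degree_numeral_mult:
  "has_degree (numeral k * p) e \<longleftrightarrow> has_degree (p :: 'a::{idom, ring_char_0} poly) e"
  by (cases "p = 0") (simp_all add: has_degree_def degree_mult_eq)

lemma quartic_expand:
  fixes t :: "'a::comm_ring_1"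
  shows "(a1 + 2 * t * b1 + t^2 * c1)^2 - 4 * (a2 + 2 * t * b2 + t^2 * c2) * (a0 + 2 * t * b0 + t^2 * c0) =
    (a1^2 - 4 * a2 * a0) + t * (4 * a1 * b1 - 8 * a2 * b0 - 8 * b2 * a0) +
    t^2 * (4 * b1^2 + (2 * (c1 * a1) - 4 * (c2 * a0) - 4 * (a2 * c0) - 16 * (b2 * b0))) +
    t^3 * (4 * (c1 * b1) - 8 * (c2 * b0) - 8 * (b2 * c0)) + t^4 * (c1^2 - 4 * c2 * c0)"
  by (simp add: algebra_simps power2_eq_square power3_eq_cube power4_eq_xxxx)

text \<open>The five-point difference formula: the even coefficients drop out of differences at
  opposite points, and the weights 8 and 1 eliminate the cubic one. It expresses T through values of
  the quartic alone.\<close>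

lemma quartic_linear_part:
  fixes A :: "'a::comm_ring_1"
  shows "12 * T = 8 * ((A + 1 * T + 1^2 * U + 1^3 * V + 1^4 * W) -
      (A + (- 1) * T + (- 1)^2 * U + (- 1)^3 * V + (- 1)^4 * W)) -
    ((A + 2 * T + 2^2 * U + 2^3 * V + 2^4 * W) - (A + (- 2) * T + (- 2)^2 * U + (- 2)^3 * V + (- 2)^4 * W))"
  by (simp add: algebra_simps)

text \<open>E is the degree of q1(v, w), and 2E that of the main term. The left sides bound the
  products of forms occurring in the parts of f(w + v) that are cubic in v or quadratic in
  both.\<close>

lemma two_scale_bounds:
  fixes N P C d K E :: nat
  assumes PC: "P < C" and NPC: "N * P < N * C" and dP: "d + P + N * P < C + N * C"
    and E: "E = d + K + Suc N * C"
  shows "2 * d + Suc N * P + E < 2 * E" "2 * d + N * P + (E + P) < 2 * E"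
    "d + K + N * C + (2 * d + Suc (Suc N) * P) < 2 * E"
    "2 * d + Suc N * P + (2 * K + Suc N * C) < 2 * E"
    "2 * d + N * P + (2 * K + Suc (Suc N) * C) < 2 * E"
    "2 * K + N * C + (2 * d + Suc (Suc N) * P) < 2 * E"
    "d + K + N * C + (E + P) < 2 * E"
proof -
  define X Y where XY: "X = N * P" "Y = N * C"
  have "X < Y" "d + P + X < C + Y" using assms XY by auto
  then show "2 * d + Suc N * P + E < 2 * E" "2 * d + N * P + (E + P) < 2 * E"
    "d + K + N * C + (2 * d + Suc (Suc N) * P) < 2 * E"
    "2 * d + Suc N * P + (2 * K + Suc N * C) < 2 * E"
    "2 * d + N * P + (2 * K + Suc (Suc N) * C) < 2 * E"
    "2 * K + N * C + (2 * d + Suc (Suc N) * P) < 2 * E"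
    "d + K + N * C + (E + P) < 2 * E"
    unfolding E mult_Suc XY[symmetric] using PC le0[of K] by simp_all
qed

text \<open>By invariance of \<open>f\<close>, a translation by the constant vector \<open>a\<close> after the shear has the same effect on
  \<open>f\<close> as a translation by \<open>w\<close> before it. The part of \<open>f (v + w)\<close> that is cubic in \<open>w\<close> is only
  small when it is read off on the side of \<open>a\<close>, the other parts only on the side of \<open>w\<close>.\<close>

locale translated = two_scales n d P K C v w
  for n d P K C :: nat and v w :: "nat \<Rightarrow> 'k::field_char_0 poly" +
  fixes a :: "nat \<Rightarrow> 'k" and v' :: "nat \<Rightarrow> 'k poly"
  assumes d1: "1 \<le> d" and dP: "d + (n - 1) * P < (n - 1) * C"
    and f_v: "deg_less (ev const_poly v (f_n n)) (Suc C)"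
    and f_inv: "\<And>t. ev const_poly (\<lambda>j. w j + t * v j) (f_n n) =
      ev const_poly (\<lambda>j. [:a j:] + t * v' j) (f_n n)"
    and v': "\<And>j. j \<in> {1..n} \<Longrightarrow> deg_less (v' j) (Suc (d + 2 * (n - 1) * C))"
begin

lemma f_w: "deg_less (ev const_poly w (f_n n)) 1"
proof -
  have "scalar_hom (\<lambda>c::'k. c)" by unfold_locales simp_all
  from hom_ev[OF scalar_hom_const_poly this, of a "f_n n"]
  have "ev const_poly w (f_n n) = [:ev (\<lambda>c. c) a (f_n n):]"
    using f_inv[of 0] by simp
  then show ?thesis by simp
qed

text \<open>Polarisation gives f(w + v) = q(v, w) + f(w) + f(v), where the last two terms have
  degree at most C and the pairing a larger one.\<close>

lemma has_degree_f_odd: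
  assumes "odd n"
  shows "has_degree (ev const_poly (\<lambda>j. w j + v j) (f_n n)) (d + K + (n - 1) * C)"
proof -
  let ?q = "qf const_poly (alt_binom (n - 1)) 1 n (n - 1)"
  note f = ev_f_n_odd[OF scalar_hom_const_poly assms]
  have "even (n - 1)" using assms by simp
  note sym = alt_binom_symmetric[OF this]
  have n: "n = 1 + (n - 1)" using n3 by simp
  have "2 * ev const_poly (\<lambda>j. w j + v j) (f_n n) = ?q w w + 2 * 1 * ?q w v + 1 ^ 2 * ?q v v"
    unfolding f using qf_add_scale[OF n sym, of const_poly w 1 v] by simp
  also have "?q w v = ?q v w" by (rule qf_symmetric[OF n sym])
  also have "?q w w + 2 * 1 * ?q v w + 1 ^ 2 * ?q v v =
      2 * (?q v w + (ev const_poly w (f_n n) + ev const_poly v (f_n n)))"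
    unfolding f[symmetric] by simp
  finally have "ev const_poly (\<lambda>j. w j + v j) (f_n n) =
      ?q v w + (ev const_poly w (f_n n) + ev const_poly v (f_n n))"
    by (simp only: mult_cancel_left) simp
  moreover have "has_degree (?q v w) (d + K + (n - 1) * C)"
    by (rule has_degree_qf_vw) (simp add: alt_binom_def)
  moreover have "1 * C \<le> (n - 1) * C" by (rule mult_le_mono1) (use n3 in simp)
  then have "Suc C \<le> d + K + (n - 1) * C" using d1 by linarith
  then have "deg_less (ev const_poly w (f_n n) + ev const_poly v (f_n n)) (d + K + (n - 1) * C)"
    by (intro deg_less_add deg_less_mono[OF f_v] deg_less_mono[OF f_w]) auto
  ultimately show ?thesis by (simp add: has_degree_add)
qed

text \<open>The part quadratic in both vectors contains 4 q1(v, w)^2, which has degree exactly 2E;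
  everything else is shown to be smaller.\<close>

lemma has_degree_f_even:
  assumes "even n"
  shows "has_degree (ev const_poly (\<lambda>j. w j + v j) (f_n n)) (2 * (d + K + (n - 1) * C))"
proof -
  obtain N where n: "n = Suc (Suc N)" using ge3_Suc_Suc[OF n3] by blast
  have N: "even N" "2 \<le> N" using assms n n3 by auto
  define E where "E = d + K + Suc N * C"
  let ?G = "\<lambda>x. 4 * ev const_poly x (f_n n) :: 'k poly"
  let ?q0 = "qf const_poly (alt_binom N) 1 (Suc N) N :: (nat \<Rightarrow> 'k poly) \<Rightarrow> _"
  let ?q1 = "qf const_poly (alt_binom_diff N) 1 n (Suc N) :: (nat \<Rightarrow> 'k poly) \<Rightarrow> _"
  let ?q2 = "qf const_poly (alt_binom N) 2 n N :: (nat \<Rightarrow> 'k poly) \<Rightarrow> _"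
  note G = ev_f_n_even[OF scalar_hom_const_poly n assms]
  note sym = alt_binom_symmetric[OF N(1)] alt_binom_diff_symmetric[OF N(1)]
  have pqR: "Suc N = 1 + N" "n = 1 + Suc N" "n = 2 + N" using n by auto
  define T where "T x y = 4 * ?q1 x x * ?q1 x y - 8 * ?q2 x x * ?q0 x y - 8 * ?q2 x y * ?q0 x x" for x y
  define U where "U x y = 2 * (?q1 y y * ?q1 x x) - 4 * (?q2 y y * ?q0 x x) - 4 * (?q2 x x * ?q0 y y) -
    16 * (?q2 x y * ?q0 x y)" for x y
  define V where "V x y = 4 * (?q1 y y * ?q1 x y) - 8 * (?q2 y y * ?q0 x y) - 8 * (?q2 x y * ?q0 y y)" for x y
  have expand: "?G (\<lambda>j. x j + t * y j) =
      ?G x + t * T x y + t^2 * (4 * ?q1 x y ^ 2 + U x y) + t^3 * V x y + t^4 * ?G y" for x y t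
    unfolding G qf_add_scale[OF pqR(1) sym(1), of const_poly x t y]
      qf_add_scale[OF pqR(2) sym(2), of const_poly x t y]
      qf_add_scale[OF pqR(3) sym(1), of const_poly x t y]
    unfolding T_def U_def V_def by (rule quartic_expand)
  have T: "12 * T x y = 8 * (?G (\<lambda>j. x j + 1 * y j) - ?G (\<lambda>j. x j + (- 1) * y j)) -
      (?G (\<lambda>j. x j + 2 * y j) - ?G (\<lambda>j. x j + (- 2) * y j))" for x y
    unfolding expand by (rule quartic_linear_part)
  \<comment> \<open>T is determined by f at w + t v for t = 1, -1, 2, -2, and f takes the same
    values at a + t v'; hence the linear coefficients agree.\<close>
  have "12 * T w v = 12 * T (\<lambda>j. [:a j:]) v'"
    unfolding T f_inv ..
  then have T_eq: "T w v = T (\<lambda>j. [:a j:]) v'" by simp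
  note flip = qf_symmetric[OF pqR(1) sym(1), of const_poly w v]
    qf_symmetric[OF pqR(2) sym(2), of const_poly w v] qf_symmetric[OF pqR(3) sym(1), of const_poly w v]
  have main: "?G (\<lambda>j. w j + v j) = 4 * ?q1 v w ^ 2 + (T w v + ?G w + ?G v + V w v + U w v)"
    using expand[of w 1 v] unfolding flip by (simp add: algebra_simps)
  have NPC: "N * P < N * C" and dP': "d + P + N * P < C + N * C" using PC N dP n by auto
  note bounds = two_scale_bounds[OF PC NPC dP' E_def]
  have q1vw: "has_degree (?q1 v w) E"
    using has_degree_qf_vw[of "alt_binom_diff N"] n by (simp add: E_def alt_binom_diff_top[OF N(1)])
  have q0vw: "deg_less (?q0 v w) (Suc (E + P))"
  proof (rule deg_less_qf_vw)
    fix r assume r: "r \<le> N"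
    have le: "(N - r) * P \<le> (N - r) * C" by (rule mult_le_mono2) (use PC in simp)
    have eq: "(N - r) * C + r * C = N * C"
      unfolding add_mult_distrib[symmetric] using r by simp
    have nr: "n - (1 + r) = Suc (N - r)" "n - (Suc N - r) = Suc r" using r n by auto
    show "d + (n - (1 + r)) * P + (K + (n - (Suc N - r)) * C) < Suc (E + P)"
      unfolding nr E_def mult_Suc using le eq by linarith
  qed (use n in auto)
  have q2vw: "deg_less (?q2 v w) (Suc (d + K + N * C))"
  proof (rule deg_less_qf_vw)
    fix r assume r: "r \<le> N"
    have le: "(N - r) * P \<le> (N - r) * C" by (rule mult_le_mono2) (use PC in simp)
    have eq: "(N - r) * C + r * C = N * C"
      unfolding add_mult_distrib[symmetric] using r by simp
    have nr: "n - (2 + r) = N - r" "n - (n - r) = r" using r n by auto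
    show "d + (n - (2 + r)) * P + (K + (n - (n - r)) * C) < Suc (d + K + N * C)"
      unfolding nr using le eq by linarith
  qed (use n in auto)
  have vv: "deg_less (?q0 v v) (Suc (2 * d + Suc (Suc N) * P))"
    "deg_less (?q1 v v) (Suc (2 * d + Suc N * P))" "deg_less (?q2 v v) (Suc (2 * d + N * P))"
    by (rule deg_less_qf_vv; use n in simp)+
  have ww: "deg_less (?q0 w w) (Suc (2 * K + Suc (Suc N) * C))"
    "deg_less (?q1 w w) (Suc (2 * K + Suc N * C))" "deg_less (?q2 w w) (Suc (2 * K + N * C))"
    by (rule deg_less_qf_ww; use n in simp)+
  have aa: "deg_less (?q0 (\<lambda>j. [:a j:]) (\<lambda>j. [:a j:])) (Suc 0)"
    "deg_less (?q1 (\<lambda>j. [:a j:]) (\<lambda>j. [:a j:])) (Suc 0)"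
    "deg_less (?q2 (\<lambda>j. [:a j:]) (\<lambda>j. [:a j:])) (Suc 0)"
    by (rule deg_less_qf[where x = "\<lambda>_. 0" and y = "\<lambda>_. 0"]; simp)+
  have av: "deg_less (?q0 (\<lambda>j. [:a j:]) v') (Suc (d + 2 * (n - 1) * C))"
    "deg_less (?q1 (\<lambda>j. [:a j:]) v') (Suc (d + 2 * (n - 1) * C))"
    "deg_less (?q2 (\<lambda>j. [:a j:]) v') (Suc (d + 2 * (n - 1) * C))"
    by (rule deg_less_qf[where x = "\<lambda>_. 0" and y = "\<lambda>_. d + 2 * (n - 1) * C"];
        (rule v')?; use n in auto)+
  \<comment> \<open>T(a, v') is linear in v' with constant coefficients, so its degree is at most d
    + 2(n-1)C, which is below 2E since d >= 1.\<close>
  have "deg_less (T w v) (2 * E)"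
    unfolding T_eq unfolding T_def mult.assoc
    by (intro deg_less_diff deg_less_numeral_mult deg_less_mult[OF aa(2) av(2)] deg_less_mult[OF aa(3) av(1)]
        deg_less_mult[OF av(3) aa(1)])
      (use d1 n in \<open>simp_all add: E_def\<close>)
  moreover have "deg_less (?G w) (2 * E)"
    by (rule deg_less_numeral_mult, rule deg_less_mono[OF f_w]) (use d1 in \<open>simp add: E_def\<close>)
  moreover have "deg_less (?G v) (2 * E)"
    by (rule deg_less_numeral_mult, rule deg_less_mono[OF f_v]) (use d1 in \<open>simp add: E_def\<close>)
  moreover have "deg_less (V w v) (2 * E)"
    unfolding V_def flip
    by (intro deg_less_diff deg_less_numeral_mult
        deg_less_mult[OF vv(2) has_degree_less[OF q1vw lessI]]
        deg_less_mult[OF vv(3) q0vw] deg_less_mult[OF q2vw vv(1)])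
      (rule bounds)+
  moreover have "deg_less (U w v) (2 * E)"
    unfolding U_def flip
    by (intro deg_less_diff deg_less_numeral_mult
        deg_less_mult[OF vv(2) ww(2)] deg_less_mult[OF vv(3) ww(1)] deg_less_mult[OF ww(3) vv(1)]
        deg_less_mult[OF q2vw q0vw])
      (rule bounds)+
  moreover have "has_degree (4 * ?q1 v w ^ 2) (2 * E)"
    unfolding has_degree_numeral_mult by (rule has_degree_power[OF q1vw])
  ultimately have "has_degree (?G (\<lambda>j. w j + v j)) (2 * E)"
    unfolding main by - (rule has_degree_add, assumption, (rule deg_less_add)+, assumption+)
  then show ?thesis unfolding has_degree_numeral_mult by (simp add: E_def n)
qed

lemma has_degree_f:
  obtains e where "has_degree (ev const_poly (\<lambda>j. w j + v j) (f_n n)) e" "d + (n - 1) * C \<le> e"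
proof (cases "odd n")
  case True
  show ?thesis by (rule that[OF has_degree_f_odd[OF True]]) simp
next
  case False
  then have "even n" by simp
  show ?thesis by (rule that[OF has_degree_f_even[OF \<open>even n\<close>]]) simp
qed

end

section \<open>Generic curves\<close>

definition generic :: "nat \<Rightarrow> nat \<Rightarrow> nat \<Rightarrow> nat \<Rightarrow> nat \<Rightarrow> (nat \<Rightarrow> 'k::field_char_0 poly) \<Rightarrow> bool" where
  "generic n l d P C v \<longleftrightarrow>
    (\<forall>j\<in>{1..n}. deg_less (v j) (Suc (d + (n - j) * P))) \<and> has_degree (v n) d \<and> 1 \<le> d \<and>
    (\<exists>e. has_degree (ev const_poly v (f_n n)) e \<and> C = l * e) \<and> d + (n - 1) * P < (n - 1) * C"

lemma generic_less: "generic n l d P C v \<Longrightarrow> P < C"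
  unfolding generic_def by (metis le_add2 le_less_trans mult_less_cancel1)

lemma generic_conj_act:
  assumes "3 \<le> n" "generic n l d P C v" "i \<noteq> 0" "j \<in> {1..n}"
  shows "has_degree (conj_act n (ev const_poly v (f_n n) ^ l) (of_int i) v j)
    (d + (n - 1) * C + (n - j) * C)"
proof -
  obtain e where e: "has_degree (ev const_poly v (f_n n)) e" "C = l * e"
    using assms(2) by (auto simp: generic_def)
  have c: "has_degree (ev const_poly v (f_n n) ^ l) C"
    unfolding e(2) by (rule has_degree_power[OF e(1)])
  have PC: "P < C" by (rule generic_less[OF assms(2)])
  have "dominated n (d + (n - 1) * C) (shear n (ev const_poly v (f_n n) ^ l) v)"
    by (rule dominated_shear[OF _ c PC]) (use assms(1,2) in \<open>auto simp: generic_def\<close>)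
  from has_degree_conj_act[OF this c _ has_degree_of_int[OF assms(3)] assms(4)] PC
  show ?thesis by simp
qed

lemma generic_translate:
  fixes a :: "nat \<Rightarrow> 'k::field_char_0"
  assumes n: "3 \<le> n" and l: "1 \<le> l" and gen: "generic n l d P C v" and i: "i \<noteq> 0"
    and a: "\<exists>j\<in>{1..n}. a j \<noteq> 0"
  obtains C' where "generic n l (d + (n - 1) * C) C C'
    (point_map const_poly (tau n a) (conj_act n (ev const_poly v (f_n n) ^ l) (of_int i) v))"
proof -
  define c where "c = ev const_poly v (f_n n) ^ l"
  obtain e where e: "has_degree (ev const_poly v (f_n n)) e" "C = l * e"
    using gen by (auto simp: generic_def)
  have c: "has_degree c C"
    unfolding e(2) c_def by (rule has_degree_power[OF e(1)])
  have PC: "P < C" by (rule generic_less[OF gen])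
  define v' where "v' = conj_act n c (of_int i) v"
  have v'_deg: "has_degree (v' j) (d + (n - 1) * C + (n - j) * C)" if "j \<in> {1..n}" for j
    unfolding v'_def c_def by (rule generic_conj_act[OF n gen i that])
  \<comment> \<open>\<open>tau\<close> ignores the entries of a outside 1..n; setting them to zero
    gives the vector a genuine last nonzero index m.\<close>
  define b where "b j = (if j \<in> {1..n} then a j else 0)" for j
  define u where "u j = [:b j:] + v' j" for j
  have u: "point_map const_poly (tau n a) v' = u"
    unfolding point_map_tau[OF scalar_hom_const_poly] u_def b_def by auto
  define m where "m = Max {j\<in>{1..n}. a j \<noteq> 0}"
  have "m \<in> {j\<in>{1..n}. a j \<noteq> 0}" unfolding m_def by (rule Max_in) (use a in auto)
  then have m: "m \<in> {1..n}" "b m \<noteq> 0" by (simp_all add: b_def)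
  have "j \<le> m" if "b j \<noteq> 0" for j
    unfolding m_def by (rule Max_ge) (use that in \<open>auto simp: b_def split: if_splits\<close>)
  then have b0: "b j = 0" if "j > m" for j using that by (meson not_le)
  \<comment> \<open>The constant vector pulled back through the same linear map that takes v to v';
    its last degree is K = (m-1)C.\<close>
  define w where "w = conj_act n c (of_int (- i)) (\<lambda>j. [:b j:])"
  have dom: "dominated n ((m - 1) * C) (shear n c (\<lambda>j. [:b j:]))"
    by (rule dominated_shear_const[of c C m n b]) (use c PC m b0 in auto)
  have w: "has_degree (w j) ((m - 1) * C + (n - j) * C)" if "j \<in> {1..n}" for j
    unfolding w_def
    by (rule has_degree_conj_act[OF dom c _ has_degree_of_int that])
      (use PC i in auto)
  have inverse: "conj_act n c (of_int i) w = (\<lambda>j. [:b j:])" "conj_act n c (of_int i) v = v'"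
    by (simp_all add: w_def v'_def conj_act_conj_act)
  have inv: "ev const_poly (\<lambda>j. w j + t * v j) (f_n n) =
      ev const_poly (\<lambda>j. [:b j:] + t * v' j) (f_n n)" for t
    using ev_f_n_conj_act[OF scalar_hom_const_poly n, of c "of_int i" "\<lambda>j. w j + t * v j"]
    unfolding conj_act_add conj_act_scale inverse by simp
  interpret translated n d P "(m - 1) * C" C v w b v'
  proof
    show "deg_less (ev const_poly v (f_n n)) (Suc C)"
    proof (rule has_degree_less[OF e(1)])
      have "1 * e \<le> C" unfolding e(2) using l by (rule mult_le_mono1)
      then show "e < Suc C" by simp
    qed
    show "deg_less (v' j) (Suc (d + 2 * (n - 1) * C))" if "j \<in> {1..n}" for j
    proof (rule has_degree_less[OF v'_deg[OF that]])
      have "(n - j) * C \<le> (n - 1) * C" by (rule mult_le_mono1) (use that in auto)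
      then show "d + (n - 1) * C + (n - j) * C < Suc (d + 2 * (n - 1) * C)"
        by (simp only: mult_2 add_mult_distrib)
    qed
  qed (use n PC gen w inv in \<open>auto simp: generic_def\<close>)
  obtain e' where e': "has_degree (ev const_poly (\<lambda>j. w j + v j) (f_n n)) e'" "d + (n - 1) * C \<le> e'"
    by (rule has_degree_f)
  have "generic n l (d + (n - 1) * C) C (l * e') u"
    unfolding generic_def
  proof (intro conjI ballI exI)
    fix j assume j: "j \<in> {1..n}"
    show "deg_less (u j) (Suc (d + (n - 1) * C + (n - j) * C))"
      unfolding u_def by (intro deg_less_add deg_less_const has_degree_less[OF v'_deg[OF j]] lessI)
  next
    have "has_degree (v' n + [:b n:]) (d + (n - 1) * C)"
      by (rule has_degree_add) (use v'_deg[of n] n d1 in \<open>auto intro: deg_less_degree\<close>)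
    then show "has_degree (u n) (d + (n - 1) * C)" by (simp add: u_def add.commute)
    show "has_degree (ev const_poly u (f_n n)) e'"
      using e'(1) inv[of 1] by (simp add: u_def[abs_def])
    \<comment> \<open>Here n >= 3 enters: twice e' is at least 2d + 2(n-1)C, which exceeds the
      required d + 2(n-1)C because d >= 1.\<close>
    have "2 * e' \<le> (n - 1) * e'" by (rule mult_le_mono1) (use n in simp)
    also have "\<dots> \<le> (n - 1) * (l * e')" by (rule mult_le_mono2) (use l in simp)
    finally show "d + (n - 1) * C + (n - 1) * C < (n - 1) * (l * e')"
      using e'(2) d1 by linarith
  qed (use d1 in simp_all)
  then show ?thesis
    using that unfolding u[symmetric] v'_def c_def by blast
qed

text \<open>The head of the word acts first, so each induction step replaces the curve by a
  translated one, again generic with new d, P, C. The bound 2 comes from d >= 1 and (n-1)C >= 1 at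
  the last power.\<close>

lemma has_degree_word:
  fixes v :: "nat \<Rightarrow> 'k::field_char_0 poly"
  assumes n: "3 \<le> n" and l: "1 \<le> l" and "generic n l d P C v"
    and "is \<noteq> []" "length as + 1 = length is" "\<forall>i\<in>set is. i \<noteq> 0"
    and "\<forall>a\<in>set as. \<exists>j\<in>{1..n}. a j \<noteq> 0"
  shows "\<exists>e\<ge>2. has_degree (point_map const_poly (word n (phi_map n l) is as) v n) e"
  using assms(3-)
proof (induction "is" arbitrary: as d P C v)
  case (Cons i is')
  note pow = point_map_phi_pow[OF scalar_hom_const_poly n]
  have i: "i \<noteq> 0" using Cons.prems by simp
  show ?case
  proof (cases is')
    case Nil
    have "has_degree (point_map const_poly (word n (phi_map n l) (i # is') as) v n) (d + (n - 1) * C)"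
      using generic_conj_act[OF n Cons.prems(1) i, of n] n by (simp add: Nil pow)
    moreover have "1 * 1 \<le> (n - 1) * C"
      by (rule mult_le_mono) (use n generic_less[OF Cons.prems(1)] in auto)
    moreover have "1 \<le> d" using Cons.prems(1) by (simp add: generic_def)
    ultimately show ?thesis by (intro exI[of _ "d + (n - 1) * C"]) linarith
  next
    case (Cons j js)
    obtain a as' where as: "as = a # as'"
      using Cons.prems(3) Cons by (cases as) auto
    obtain C' where C': "generic n l (d + (n - 1) * C) C C'
        (point_map const_poly (tau n a) (conj_act n (ev const_poly v (f_n n) ^ l) (of_int i) v))"
      by (rule generic_translate[OF n l Cons.prems(1) i, of a]) (use Cons.prems(5) as in auto)
    have "\<exists>e\<ge>2. has_degree (point_map const_poly (word n (phi_map n l) is' as')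
        (point_map const_poly (tau n a) (conj_act n (ev const_poly v (f_n n) ^ l) (of_int i) v)) n) e"
      by (rule Cons.IH[OF C']) (use Cons.prems as Cons in auto)
    then show ?thesis
      by (simp add: Cons as point_map_comp_aut[OF scalar_hom_const_poly] pow)
  qed
qed simp

text \<open>Both end coordinates are switched on so that the monomial x_1 x_n survives: f becomes
  t^2 for odd n and t^4 for even n.\<close>

definition start :: "nat \<Rightarrow> nat \<Rightarrow> 'k::field_char_0 poly" where
  "start n j = (if j = 1 \<or> j = n then [:0, 1:] else 0)"

lemma has_degree_X: "has_degree ([:0, 1:] :: 'k::field_char_0 poly) 1"
  by (simp add: has_degree_def)

lemma qf_start:
  assumes "3 \<le> n" "b 0 = 1" "b (n - 1) = 1"
  shows "qf const_poly b 1 n (n - 1) (start n) (start n) = (2 * [:0, 1:] ^ 2 :: 'k::field_char_0 poly)"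
proof -
  have "qf const_poly b 1 n (n - 1) (start n) (start n) =
      (\<Sum>r\<in>{0, n - 1}. [:b r:] * start n (1 + r) * start n (n - r))"
    unfolding qf_def by (rule sum.mono_neutral_right) (use assms(1) in \<open>auto simp: start_def\<close>)
  also have "\<dots> = 2 * [:0, 1:] ^ 2"
    using assms by (simp add: start_def power2_eq_square numeral_poly)
  finally show ?thesis .
qed

lemma has_degree_f_start:
  assumes "3 \<le> n"
  obtains e where "2 \<le> e" "has_degree (ev const_poly (start n) (f_n n) :: 'k::field_char_0 poly) e"
proof (cases "odd n")
  case True
  have "2 * ev const_poly (start n) (f_n n) = (2 * [:0, 1:] ^ 2 :: 'k poly)"
    unfolding ev_f_n_odd[OF scalar_hom_const_poly True]
    by (rule qf_start) (use assms True in \<open>auto simp: alt_binom_def\<close>)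
  then have "ev const_poly (start n) (f_n n) = ([:0, 1:] ^ 2 :: 'k poly)" by (simp only: mult_cancel_left) simp
  then show ?thesis using that[of 2] has_degree_power[OF has_degree_X, of 2] by simp
next
  case False
  obtain N where n: "n = Suc (Suc N)" using ge3_Suc_Suc[OF assms] by blast
  have N: "even N" using n False by simp
  \<comment> \<open>The products in q0 have index sum n, whereas two indices from {1, n} sum to 2, n
    + 1 or 2n.\<close>
  have "qf const_poly (alt_binom N) 1 (Suc N) N (start n) (start n) = (0 :: 'k poly)"
    unfolding qf_def by (rule sum.neutral) (use assms n N in \<open>auto simp: start_def\<close>)
  moreover have "qf const_poly (alt_binom_diff N) 1 n (Suc N) (start n) (start n) = (2 * [:0, 1:] ^ 2 :: 'k poly)"
    using qf_start[OF assms, of "alt_binom_diff N"] alt_binom_diff_top[OF N] n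
    by (simp add: alt_binom_diff_def)
  ultimately have "4 * ev const_poly (start n) (f_n n) = (4 * [:0, 1:] ^ 4 :: 'k poly)"
    unfolding ev_f_n_even[OF scalar_hom_const_poly n False[simplified]]
    by (simp add: power_mult_distrib flip: power_mult)
  then have "ev const_poly (start n) (f_n n) = ([:0, 1:] ^ 4 :: 'k poly)" by (simp only: mult_cancel_left) simp
  then show ?thesis using that[of 4] has_degree_power[OF has_degree_X, of 4] by simp
qed

lemma generic_start:
  assumes "3 \<le> n" "1 \<le> l"
  obtains C where "generic n l 1 0 C (start n :: nat \<Rightarrow> 'k::field_char_0 poly)"
proof -
  obtain e where e: "2 \<le> e" "has_degree (ev const_poly (start n) (f_n n) :: 'k poly) e"
    by (rule has_degree_f_start[OF assms(1)])
  have "2 * 1 \<le> (n - 1) * (l * e)"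
    by (rule mult_le_mono) (use assms e in auto)
  then have "generic n l 1 0 (l * e) (start n :: nat \<Rightarrow> 'k poly)"
    using e has_degree_X by (auto simp: generic_def start_def intro!: deg_less_degree)
  then show ?thesis by (rule that)
qed

theorem theorem2p2:
  fixes n l :: nat and "is" :: "int list" and as :: "(nat \<Rightarrow> 'k::field_char_0) list"
  assumes "n \<ge> 3" and "l \<ge> 1"
    and "is \<noteq> []" and "length as + 1 = length is"
    and "\<forall>i\<in>set is. i \<noteq> 0"
    and "\<forall>a\<in>set as. \<exists>j\<in>{1..n}. a j \<noteq> 0"
  shows "\<not> is_affine n (word n (phi_map n l :: nat \<Rightarrow> 'k mpoly) is as)"
proof
  interpret h: scalar_hom "const_poly :: 'k \<Rightarrow> _" by (rule scalar_hom_const_poly)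
  let ?w = "word n (phi_map n l :: nat \<Rightarrow> 'k mpoly) is as"
  assume "is_affine n ?w"
  then obtain A b where w: "?w n = (\<Sum>i=1..n. Const (A i n) * Var i) + Const (b n)"
    unfolding is_affine_def using assms(1) by fastforce
  have "degree (\<Sum>i=1..n. [:A i n:] * start n i) \<le> 1"
    by (rule degree_sum_le) (auto simp: start_def)
  then have "degree (point_map const_poly ?w (start n) n) \<le> 1"
    by (auto simp: point_map_def w h.ev_add h.ev_mult h.ev_sum intro: degree_add_le)
  moreover obtain C where "generic n l 1 0 C (start n :: nat \<Rightarrow> 'k poly)"
    by (rule generic_start[OF assms(1,2)])
  then have "\<exists>e\<ge>2. has_degree (point_map const_poly ?w (start n) n) e"
    by (rule has_degree_word[OF assms(1,2) _ assms(3-6)])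
  ultimately show False by (auto simp: has_degree_def)
qed

end
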